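(* Let $(H,R)$ be a finite dimensional semisimple and cosemisimple quasi-triangular Hopf algebra over a field $k$. Then there is a unique decomposition $$H_R=D_1\oplus\cdots\oplus D_r$$ into minimal $H$-adjoint-stable subcoalgebras $D_1,\ldots,D_r$ of $H_R$. It is also the decomposition of $H\in{}_H^H\mathcal{YD}$ as a direct sum of irreducible Yetter-Drinfeld modules.
   Context: $H$ has coproduct $\Delta(h)=\sum h_{(1)}\otimes h_{(2)}$, counit $\varepsilon$ and antipode $S$. Quasi-triangular: $R=\sum R^1\otimes R^2\in H\otimes H$ is invertible with $\sum R^1h_{(1)}\otimes R^2h_{(2)}=\sum h_{(2)}R^1\otimes h_{(1)}R^2$ for all $h\in H$, $(\Delta\otimes id)(R)=R^{13}R^{23}$, $(id\otimes\Delta)(R)=R^{13}R^{12}$. Left adjoint action: $h\cdot_{ad}a=\sum h_{(1)}aS(h_{(2)})$. Transmuted braided group $H_R$: the vector space $H$ with the action $\cdot_{ad}$ and the (coassociative) coproduct $\Delta_R(h)=\sum h_{(1)}S(R^2)\otimes R^1\cdot_{ad}h_{(2)}$ and counit $\varepsilon$. A minimal $H$-adjoint-stable subcoalgebra is a nonzero subcoalgebra of $(H_R,\Delta_R)$ stable under $\cdot_{ad}$ and minimal with these properties. ${}_H^H\mathcal{YD}$ is the category of left-left Yetter-Drinfeld modules: left $H$-modules and left $H$-comodules $V$ with $\sum(hv)_{\langle-1\rangle}\otimes(hv)_{\langle0\rangle}=\sum h_{(1)}v_{\langle-1\rangle}S(h_{(3)})\otimes h_{(2)}v_{\langle0\rangle}$.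 $H$ is regarded as an object of ${}_H^H\mathcal{YD}$ with action $\cdot_{ad}$ and coaction $\Delta$. *)

theory Defs
  imports Complex_Main "HOL-Library.Poly_Mapping"
begin

section \<open>Tensors\<close>

text \<open>
  In the style of Sweedler notation, an element of A (x) B is presented by a finite sum of pure
  tensors, written as a list of pairs; scalars are absorbed into the vectors.  Two lists denote the
  same element iff the corresponding formal sums agree in the quotient of the free vector space on
  A x B by the bilinearity relations, i.e. in the tensor product.  Threefold tensors are treated
  likewise.  Structure maps with values in a tensor product (such as a coproduct) are thus given by
  representatives, and every axiom about them is an equality in the tensor product, never an
  equality of lists.
\<close>

definition scale_formal :: "'k::field \<Rightarrow> ('x \<Rightarrow>\<^sub>0 'k) \<Rightarrow> ('x \<Rightarrow>\<^sub>0 'k)" where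
  "scale_formal c f = Poly_Mapping.map ((*) c) f"

lemma lookup_scale_formal: "Poly_Mapping.lookup (scale_formal c f) x = c * Poly_Mapping.lookup f x"
  by (simp add: scale_formal_def Poly_Mapping.map.rep_eq when_def)

interpretation formal: vector_space scale_formal
  by unfold_locales
    (rule poly_mapping_eqI, simp add: lookup_scale_formal lookup_add algebra_simps)+

definition formal_sum :: "'x list \<Rightarrow> ('x \<Rightarrow>\<^sub>0 'k::field)" where
  "formal_sum xs = (\<Sum>x\<leftarrow>xs. Poly_Mapping.single x 1)"

definition tensor_relations ::
  "('k::field \<Rightarrow> 'a::ab_group_add \<Rightarrow> 'a) \<Rightarrow> ('k \<Rightarrow> 'b::ab_group_add \<Rightarrow> 'b) \<Rightarrow> ('a \<times> 'b \<Rightarrow>\<^sub>0 'k) set"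
where
  "tensor_relations sA sB =
     {Poly_Mapping.single (a + a', b) 1 - Poly_Mapping.single (a, b) 1
        - Poly_Mapping.single (a', b) 1 | a a' b. True} \<union>
     {Poly_Mapping.single (a, b + b') 1 - Poly_Mapping.single (a, b) 1
        - Poly_Mapping.single (a, b') 1 | a b b'. True} \<union>
     {Poly_Mapping.single (sA c a, b) 1 - Poly_Mapping.single (a, b) c | c a b. True} \<union>
     {Poly_Mapping.single (a, sB c b) 1 - Poly_Mapping.single (a, b) c | c a b. True}"

definition tensor_eq ::
  "('k::field \<Rightarrow> 'a::ab_group_add \<Rightarrow> 'a) \<Rightarrow> ('k \<Rightarrow> 'b::ab_group_add \<Rightarrow> 'b)
    \<Rightarrow> ('a \<times> 'b) list \<Rightarrow> ('a \<times> 'b) list \<Rightarrow> bool"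
where
  "tensor_eq sA sB s t \<longleftrightarrow>
     formal_sum s - formal_sum t \<in> module.span scale_formal (tensor_relations sA sB)"

definition tensor3_relations ::
  "('k::field \<Rightarrow> 'a::ab_group_add \<Rightarrow> 'a) \<Rightarrow> ('k \<Rightarrow> 'b::ab_group_add \<Rightarrow> 'b)
    \<Rightarrow> ('k \<Rightarrow> 'c::ab_group_add \<Rightarrow> 'c) \<Rightarrow> ('a \<times> 'b \<times> 'c \<Rightarrow>\<^sub>0 'k) set"
where
  "tensor3_relations sA sB sC =
     {Poly_Mapping.single (a + a', b, c) 1 - Poly_Mapping.single (a, b, c) 1
        - Poly_Mapping.single (a', b, c) 1 | a a' b c. True} \<union>
     {Poly_Mapping.single (a, b + b', c) 1 - Poly_Mapping.single (a, b, c) 1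
        - Poly_Mapping.single (a, b', c) 1 | a b b' c. True} \<union>
     {Poly_Mapping.single (a, b, c + c') 1 - Poly_Mapping.single (a, b, c) 1
        - Poly_Mapping.single (a, b, c') 1 | a b c c'. True} \<union>
     {Poly_Mapping.single (sA \<kappa> a, b, c) 1 - Poly_Mapping.single (a, b, c) \<kappa> | \<kappa> a b c. True} \<union>
     {Poly_Mapping.single (a, sB \<kappa> b, c) 1 - Poly_Mapping.single (a, b, c) \<kappa> | \<kappa> a b c. True} \<union>
     {Poly_Mapping.single (a, b, sC \<kappa> c) 1 - Poly_Mapping.single (a, b, c) \<kappa> | \<kappa> a b c. True}"

definition tensor3_eq ::
  "('k::field \<Rightarrow> 'a::ab_group_add \<Rightarrow> 'a) \<Rightarrow> ('k \<Rightarrow> 'b::ab_group_add \<Rightarrow> 'b)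
    \<Rightarrow> ('k \<Rightarrow> 'c::ab_group_add \<Rightarrow> 'c) \<Rightarrow> ('a \<times> 'b \<times> 'c) list \<Rightarrow> ('a \<times> 'b \<times> 'c) list \<Rightarrow> bool"
where
  "tensor3_eq sA sB sC s t \<longleftrightarrow>
     formal_sum s - formal_sum t \<in> module.span scale_formal (tensor3_relations sA sB sC)"

text \<open>For subspaces U of A and W of B: the element presented by t lies in the subspace
  U (x) W of A (x) B.\<close>

definition in_tensor ::
  "('k::field \<Rightarrow> 'a::ab_group_add \<Rightarrow> 'a) \<Rightarrow> ('k \<Rightarrow> 'b::ab_group_add \<Rightarrow> 'b)
    \<Rightarrow> 'a set \<Rightarrow> 'b set \<Rightarrow> ('a \<times> 'b) list \<Rightarrow> bool"
where
  "in_tensor sA sB U W t \<longleftrightarrow> (\<exists>s. set s \<subseteq> U \<times> W \<and> tensor_eq sA sB t s)"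

definition linear_to_tensor ::
  "('k::field \<Rightarrow> 'c::ab_group_add \<Rightarrow> 'c) \<Rightarrow> ('k \<Rightarrow> 'a::ab_group_add \<Rightarrow> 'a)
    \<Rightarrow> ('k \<Rightarrow> 'b::ab_group_add \<Rightarrow> 'b) \<Rightarrow> ('c \<Rightarrow> ('a \<times> 'b) list) \<Rightarrow> bool"
where
  "linear_to_tensor sC sA sB f \<longleftrightarrow>
     (\<forall>x y. tensor_eq sA sB (f (x + y)) (f x @ f y)) \<and>
     (\<forall>c x. tensor_eq sA sB (f (sC c x)) [(sA c a, b). (a, b) \<leftarrow> f x])"

definition map_first :: "('a \<Rightarrow> ('c \<times> 'd) list) \<Rightarrow> ('a \<times> 'b) list \<Rightarrow> ('c \<times> 'd \<times> 'b) list" where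
  "map_first f t = [(c, d, b). (a, b) \<leftarrow> t, (c, d) \<leftarrow> f a]"

definition map_second :: "('b \<Rightarrow> ('c \<times> 'd) list) \<Rightarrow> ('a \<times> 'b) list \<Rightarrow> ('a \<times> 'c \<times> 'd) list" where
  "map_second f t = [(a, c, d). (a, b) \<leftarrow> t, (c, d) \<leftarrow> f b]"

definition tensor_mult :: "('a::times \<times> 'a) list \<Rightarrow> ('a \<times> 'a) list \<Rightarrow> ('a \<times> 'a) list" where
  "tensor_mult s t = [(a * c, b * d). (a, b) \<leftarrow> s, (c, d) \<leftarrow> t]"

definition tensor3_mult ::
  "('a::times \<times> 'a \<times> 'a) list \<Rightarrow> ('a \<times> 'a \<times> 'a) list \<Rightarrow> ('a \<times> 'a \<times> 'a) list"
where
  "tensor3_mult s t = [(a * a', b * b', c * c'). (a, b, c) \<leftarrow> s, (a', b', c') \<leftarrow> t]"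

definition leg12 :: "('a::one \<times> 'a) list \<Rightarrow> ('a \<times> 'a \<times> 'a) list" where
  "leg12 t = [(a, b, 1). (a, b) \<leftarrow> t]"

definition leg13 :: "('a::one \<times> 'a) list \<Rightarrow> ('a \<times> 'a \<times> 'a) list" where
  "leg13 t = [(a, 1, b). (a, b) \<leftarrow> t]"

definition leg23 :: "('a::one \<times> 'a) list \<Rightarrow> ('a \<times> 'a \<times> 'a) list" where
  "leg23 t = [(1, a, b). (a, b) \<leftarrow> t]"


section \<open>Hopf algebras\<close>

locale coalgebra = vector_space scale
  for scale :: "'k::field \<Rightarrow> 'h::ab_group_add \<Rightarrow> 'h" +
  fixes comult :: "'h \<Rightarrow> ('h \<times> 'h) list" and counit :: "'h \<Rightarrow> 'k"
  assumes comult_linear: "linear_to_tensor scale scale scale comult"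
    and counit_linear: "Vector_Spaces.linear scale (*) counit"
    and coassoc: "tensor3_eq scale scale scale
      (map_first comult (comult h)) (map_second comult (comult h))"
    and counit_left: "(\<Sum>(a, b)\<leftarrow>comult h. scale (counit a) b) = h"
    and counit_right: "(\<Sum>(a, b)\<leftarrow>comult h. scale (counit b) a) = h"

locale hopf_algebra = coalgebra scale comult counit
  for scale :: "'k::field \<Rightarrow> 'h::ring_1 \<Rightarrow> 'h" and comult counit +
  fixes antipode :: "'h \<Rightarrow> 'h"
  assumes scale_mult_left: "scale c x * y = scale c (x * y)"
    and scale_mult_right: "x * scale c y = scale c (x * y)"
    and comult_mult: "tensor_eq scale scale (comult (x * y)) (tensor_mult (comult x) (comult y))"
    and comult_one: "tensor_eq scale scale (comult 1) [(1, 1)]"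
    and counit_mult: "counit (x * y) = counit x * counit y"
    and counit_one: "counit 1 = 1"
    and antipode_linear: "Vector_Spaces.linear scale scale antipode"
    and antipode_left: "(\<Sum>(a, b)\<leftarrow>comult h. antipode a * b) = scale (counit h) 1"
    and antipode_right: "(\<Sum>(a, b)\<leftarrow>comult h. a * antipode b) = scale (counit h) 1"

locale quasitriangular_hopf_algebra = hopf_algebra scale comult counit antipode
  for scale :: "'k::field \<Rightarrow> 'h::ring_1 \<Rightarrow> 'h" and comult counit antipode +
  fixes R :: "('h \<times> 'h) list"
  assumes R_invertible: "\<exists>Q. tensor_eq scale scale (tensor_mult R Q) [(1, 1)] \<and>
      tensor_eq scale scale (tensor_mult Q R) [(1, 1)]"
    and R_comult: "tensor_eq scale scale
      (tensor_mult R (comult h)) (tensor_mult [(b, a). (a, b) \<leftarrow> comult h] R)"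
    and comult_first_R: "tensor3_eq scale scale scale
      (map_first comult R) (tensor3_mult (leg13 R) (leg23 R))"
    and comult_second_R: "tensor3_eq scale scale scale
      (map_second comult R) (tensor3_mult (leg13 R) (leg12 R))"

definition finite_dimensional :: "('k::field \<Rightarrow> 'h::ab_group_add \<Rightarrow> 'h) \<Rightarrow> bool" where
  "finite_dimensional scale \<longleftrightarrow> (\<exists>B. finite B \<and> module.span scale B = UNIV)"


section \<open>Direct sums, semisimplicity and cosemisimplicity\<close>

text \<open>A decomposition of the whole space is a set of subspaces, so it carries no ordering; nothing
  is lost because the summands below are nonzero and hence pairwise distinct.\<close>

definition direct_sum_decomposition ::
  "('k::field \<Rightarrow> 'h::ab_group_add \<Rightarrow> 'h) \<Rightarrow> 'h set set \<Rightarrow> bool"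
where
  "direct_sum_decomposition scale \<D> \<longleftrightarrow>
     (\<forall>D\<in>\<D>. module.subspace scale D) \<and>
     module.span scale (\<Union>\<D>) = UNIV \<and>
     (\<forall>D\<in>\<D>. D \<inter> module.span scale (\<Union>(\<D> - {D})) = {0})"

definition minimal_nonzero :: "('h::zero set \<Rightarrow> bool) \<Rightarrow> 'h set \<Rightarrow> bool" where
  "minimal_nonzero P D \<longleftrightarrow>
     P D \<and> D \<noteq> {0} \<and> (\<forall>E. P E \<and> E \<noteq> {0} \<and> E \<subseteq> D \<longrightarrow> E = D)"

definition left_ideal :: "('k::field \<Rightarrow> 'h::ring_1 \<Rightarrow> 'h) \<Rightarrow> 'h set \<Rightarrow> bool" where
  "left_ideal scale L \<longleftrightarrow> module.subspace scale L \<and> (\<forall>h. \<forall>x\<in>L. h * x \<in> L)"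

text \<open>H is a direct sum of simple left H-modules, respectively of simple subcoalgebras.\<close>

definition semisimple_algebra :: "('k::field \<Rightarrow> 'h::ring_1 \<Rightarrow> 'h) \<Rightarrow> bool" where
  "semisimple_algebra scale \<longleftrightarrow>
     (\<exists>\<L>. direct_sum_decomposition scale \<L> \<and> (\<forall>L\<in>\<L>. minimal_nonzero (left_ideal scale) L))"

definition subcoalgebra ::
  "('k::field \<Rightarrow> 'h::ab_group_add \<Rightarrow> 'h) \<Rightarrow> ('h \<Rightarrow> ('h \<times> 'h) list) \<Rightarrow> 'h set \<Rightarrow> bool"
where
  "subcoalgebra scale comult D \<longleftrightarrow>
     module.subspace scale D \<and> (\<forall>d\<in>D. in_tensor scale scale D D (comult d))"

definition cosemisimple_coalgebra ::
  "('k::field \<Rightarrow> 'h::ab_group_add \<Rightarrow> 'h) \<Rightarrow> ('h \<Rightarrow> ('h \<times> 'h) list) \<Rightarrow> bool"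
where
  "cosemisimple_coalgebra scale comult \<longleftrightarrow>
     (\<exists>\<C>. direct_sum_decomposition scale \<C> \<and>
          (\<forall>C\<in>\<C>. minimal_nonzero (subcoalgebra scale comult) C))"


section \<open>The transmuted braided group\<close>

definition adjoint_action ::
  "('h::ring_1 \<Rightarrow> ('h \<times> 'h) list) \<Rightarrow> ('h \<Rightarrow> 'h) \<Rightarrow> 'h \<Rightarrow> 'h \<Rightarrow> 'h"
where
  "adjoint_action comult antipode h a = (\<Sum>(h1, h2)\<leftarrow>comult h. h1 * a * antipode h2)"

definition transmuted_comult ::
  "('h::ring_1 \<Rightarrow> ('h \<times> 'h) list) \<Rightarrow> ('h \<Rightarrow> 'h) \<Rightarrow> ('h \<times> 'h) list \<Rightarrow> 'h \<Rightarrow> ('h \<times> 'h) list"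
where
  "transmuted_comult comult antipode R h =
     [(h1 * antipode R2, adjoint_action comult antipode R1 h2).
        (h1, h2) \<leftarrow> comult h, (R1, R2) \<leftarrow> R]"

definition adjoint_stable_subcoalgebra ::
  "('k::field \<Rightarrow> 'h::ring_1 \<Rightarrow> 'h) \<Rightarrow> ('h \<Rightarrow> ('h \<times> 'h) list) \<Rightarrow> ('h \<Rightarrow> 'h)
    \<Rightarrow> ('h \<times> 'h) list \<Rightarrow> 'h set \<Rightarrow> bool"
where
  "adjoint_stable_subcoalgebra scale comult antipode R D \<longleftrightarrow>
     subcoalgebra scale (transmuted_comult comult antipode R) D \<and>
     (\<forall>h. \<forall>d\<in>D. adjoint_action comult antipode h d \<in> D)"


section \<open>Yetter-Drinfeld modules\<close>

locale yetter_drinfeld_module =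
  hopf_algebra scale comult counit antipode + V: vector_space scaleV
  for scale :: "'k::field \<Rightarrow> 'h::ring_1 \<Rightarrow> 'h" and comult counit antipode
    and scaleV :: "'k \<Rightarrow> 'v::ab_group_add \<Rightarrow> 'v" +
  fixes act :: "'h \<Rightarrow> 'v \<Rightarrow> 'v" and coact :: "'v \<Rightarrow> ('h \<times> 'v) list"
  assumes act_linear_left: "Vector_Spaces.linear scale scaleV (\<lambda>h. act h v)"
    and act_linear_right: "Vector_Spaces.linear scaleV scaleV (act h)"
    and act_one: "act 1 v = v"
    and act_mult: "act (g * h) v = act g (act h v)"
    and coact_linear: "linear_to_tensor scaleV scale scaleV coact"
    and coact_coassoc: "tensor3_eq scale scale scaleV
      (map_first comult (coact v)) (map_second coact (coact v))"
    and coact_counit: "(\<Sum>(a, w)\<leftarrow>coact v. scaleV (counit a) w) = v"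
    and yetter_drinfeld: "tensor_eq scale scaleV (coact (act h v))
      [(h1 * a * antipode h3, act h2 w).
         (h1, h2, h3) \<leftarrow> map_first comult (comult h), (a, w) \<leftarrow> coact v]"

definition yetter_drinfeld_submodule ::
  "('k::field \<Rightarrow> 'h::ring_1 \<Rightarrow> 'h) \<Rightarrow> ('k \<Rightarrow> 'v::ab_group_add \<Rightarrow> 'v)
    \<Rightarrow> ('h \<Rightarrow> 'v \<Rightarrow> 'v) \<Rightarrow> ('v \<Rightarrow> ('h \<times> 'v) list) \<Rightarrow> 'v set \<Rightarrow> bool"
where
  "yetter_drinfeld_submodule scale scaleV act coact W \<longleftrightarrow>
     module.subspace scaleV W \<and>
     (\<forall>h. \<forall>w\<in>W. act h w \<in> W) \<and>
     (\<forall>w\<in>W. in_tensor scale scaleV UNIV W (coact w))"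

definition minimal_subcoalgebra_decomposition ::
  "('k::field \<Rightarrow> 'h::ring_1 \<Rightarrow> 'h) \<Rightarrow> ('h \<Rightarrow> ('h \<times> 'h) list) \<Rightarrow> ('h \<Rightarrow> 'h)
    \<Rightarrow> ('h \<times> 'h) list \<Rightarrow> 'h set set \<Rightarrow> bool"
where
  "minimal_subcoalgebra_decomposition scale comult antipode R \<D> \<longleftrightarrow>
     finite \<D> \<and> direct_sum_decomposition scale \<D> \<and>
     (\<forall>D\<in>\<D>. minimal_nonzero (adjoint_stable_subcoalgebra scale comult antipode R) D)"

definition irreducible_yetter_drinfeld_decomposition ::
  "('k::field \<Rightarrow> 'h::ring_1 \<Rightarrow> 'h) \<Rightarrow> ('h \<Rightarrow> ('h \<times> 'h) list) \<Rightarrow> ('h \<Rightarrow> 'h) \<Rightarrow> 'h set set \<Rightarrow> bool"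
where
  "irreducible_yetter_drinfeld_decomposition scale comult antipode \<D> \<longleftrightarrow>
     finite \<D> \<and> direct_sum_decomposition scale \<D> \<and>
     (\<forall>D\<in>\<D>. minimal_nonzero
        (yetter_drinfeld_submodule scale scale (adjoint_action comult antipode) comult) D)"

end

theory Submission
  imports Defs
begin

text \<open>
  Write \<cdot> for the adjoint action and h1, h2 for the legs of \<Delta>(h).

  The minimal adjoint-stable subcoalgebras of H_R and the irreducible Yetter-Drinfeld submodules of H are
  the same subspaces, because an adjoint-stable subcoalgebra of H_R is nothing but a Yetter-Drinfeld
  submodule of H (adjoint_stable_subcoalgebra_iff_yetter_drinfeld_submodule). The latter is an ad-stable
  subspace D with \<Delta>(D) contained in H \<otimes> D. The definition \<Delta>_R(h) = h1 S(R2) \<otimes> R1 \<cdot> h2 shows that \<Delta>_R(D) is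
  then contained in H \<otimes> D, and as R is invertible this can be reversed (sw_from_tw). On the other hand
  quasi-cocommutativity, the formulas for (\<Delta> \<otimes> id)(R) and (id \<otimes> \<Delta>)(R), and (S \<otimes> S)(R) = R transform
  the definition into \<Delta>_R(h) = R2 \<cdot> h2 \<otimes> R1 h1 (tw_braided), so that \<Delta>_R(D) is contained in D \<otimes> H as well, hence in D \<otimes> D.

  Complete reducibility is Maschke's theorem (yetter_drinfeld_complement). Semisimplicity provides an
  integral \<Lambda> with \<epsilon>(\<Lambda>) = 1 and cosemisimplicity a cointegral \<mu> with \<mu>(1) = 1. Averaging a linear projection
  over \<Lambda> makes it H-linear, and averaging the result over \<mu> makes it colinear. The second average keeps
  H-linearity since \<mu>(y a) = \<mu>(S(S(a)) y), an identity that rests on both integrals (cointegral_trace).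

  Uniqueness comes from the coalgebra structure (adjoint_stable_subcoalgebra_separation). If H_R is the
  direct sum of subcoalgebras E and E', the projection onto E can be expressed by \<Delta>_R and a linear form,
  so it preserves every subcoalgebra. Therefore a minimal one different from a minimal E lies in E'. It
  follows that the minimal ones are independent, and that the decomposition consists of all of them
  (unique_decomposition_into_minimals).
\<close>


section \<open>Evaluation of tensors by multilinear maps\<close>

definition linear_extension ::
  "('k::field \<Rightarrow> 'v::ab_group_add \<Rightarrow> 'v) \<Rightarrow> ('x \<Rightarrow> 'v) \<Rightarrow> ('x \<Rightarrow>\<^sub>0 'k) \<Rightarrow> 'v"
where
  "linear_extension sV \<beta> p =
     (\<Sum>x\<in>Poly_Mapping.keys p. sV (Poly_Mapping.lookup p x) (\<beta> x))"

lemma linear_extension_superset: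
  assumes "vector_space sV" "finite X" "Poly_Mapping.keys p \<subseteq> X"
  shows "linear_extension sV \<beta> p = (\<Sum>x\<in>X. sV (Poly_Mapping.lookup p x) (\<beta> x))"
proof -
  interpret vector_space sV by fact
  show ?thesis
    unfolding linear_extension_def using assms(2,3)
    by (intro sum.mono_neutral_left) (auto simp: in_keys_iff)
qed

lemma linear_linear_extension:
  assumes "vector_space sV"
  shows "Vector_Spaces.linear scale_formal sV (linear_extension sV \<beta>)"
proof -
  interpret vector_space sV by fact
  have "linear_extension sV \<beta> (p + q) = linear_extension sV \<beta> p + linear_extension sV \<beta> q" for p q
  proof -
    let ?X = "Poly_Mapping.keys p \<union> Poly_Mapping.keys q"
    have "Poly_Mapping.keys (p + q) \<subseteq> ?X" by (rule Poly_Mapping.keys_add)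
    then show ?thesis
      by (simp add: linear_extension_superset[OF assms, of ?X] lookup_add scale_left_distrib
          sum.distrib)
  qed
  moreover have "linear_extension sV \<beta> (scale_formal c p) = sV c (linear_extension sV \<beta> p)" for c p
  proof -
    have "Poly_Mapping.keys (scale_formal c p) \<subseteq> Poly_Mapping.keys p"
      by (auto simp: in_keys_iff lookup_scale_formal)
    then show ?thesis
      by (simp add: linear_extension_superset[OF assms, of "Poly_Mapping.keys p"]
          lookup_scale_formal scale_sum_right)
  qed
  ultimately show ?thesis
    by (intro Vector_Spaces.linear.intro assms formal.vector_space_axioms module_hom.intro
        module_hom_axioms.intro) (auto intro: formal.module_axioms module_axioms)
qed

lemma linear_extension_single [simp]:
  assumes "vector_space sV"
  shows "linear_extension sV \<beta> (Poly_Mapping.single x c) = sV c (\<beta> x)"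
proof -
  interpret vector_space sV by fact
  show ?thesis by (simp add: linear_extension_def)
qed

lemma linear_extension_formal_sum:
  assumes "vector_space sV"
  shows "linear_extension sV \<beta> (formal_sum xs) = (\<Sum>x\<leftarrow>xs. \<beta> x)"
proof -
  interpret vector_space sV by fact
  interpret L: Vector_Spaces.linear scale_formal sV "linear_extension sV \<beta>"
    by (rule linear_linear_extension[OF assms])
  show ?thesis
    by (induction xs) (simp_all add: formal_sum_def L.add L.zero linear_extension_single[OF assms])
qed

text \<open>
  The universal property of a presented quotient: a map that kills the relations takes equal values
  on two formal sums that agree in the quotient.
\<close>

lemma formal_sums_agree:
  assumes V: "vector_space sV"
    and rel: "\<And>r. r \<in> X \<Longrightarrow> linear_extension sV \<beta> r = 0"
    and eq: "formal_sum s - formal_sum t \<in> module.span scale_formal X"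
  shows "(\<Sum>x\<leftarrow>s. \<beta> x) = (\<Sum>x\<leftarrow>t. \<beta> x)"
proof -
  interpret L: Vector_Spaces.linear scale_formal sV "linear_extension sV \<beta>"
    by (rule linear_linear_extension[OF V])
  have "linear_extension sV \<beta> (formal_sum s - formal_sum t) = 0"
    using L.eq_0_on_span[of X] rel eq by blast
  then show ?thesis
    by (simp add: L.diff linear_extension_formal_sum[OF V])
qed

text \<open>
  The linear map A \<otimes> B \<rightarrow> V induced by a bilinear map \<beta>, evaluated on a representative. Sweedler
  notation becomes nested expressions of this form: the product h1 S(h2), for instance, is
  tsum (comult h) (\<lambda>a b. a * antipode b). An equality of tensors is used by evaluating both sides with a
  bilinear map of one's choice, and such a choice is what turns an axiom into a rewriting step.
\<close>

definition tsum :: "('a \<times> 'b) list \<Rightarrow> ('a \<Rightarrow> 'b \<Rightarrow> 'v) \<Rightarrow> 'v::comm_monoid_add" where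
  "tsum t \<beta> = (\<Sum>(a, b)\<leftarrow>t. \<beta> a b)"

lemma tsum_tensor_eq:
  assumes eq: "tensor_eq sA sB s t"
    and l1: "\<And>b. Vector_Spaces.linear sA sV (\<lambda>a. \<beta> a b)"
    and l2: "\<And>a. Vector_Spaces.linear sB sV (\<lambda>b. \<beta> a b)"
  shows "tsum s \<beta> = tsum t \<beta>"
proof -
  interpret l1: Vector_Spaces.linear sA sV "\<lambda>a. \<beta> a b" for b by (rule l1)
  interpret l2: Vector_Spaces.linear sB sV "\<lambda>b. \<beta> a b" for a by (rule l2)
  have V: "vector_space sV" by (rule l1.vs2.vector_space_axioms)
  interpret L: Vector_Spaces.linear scale_formal sV "linear_extension sV (\<lambda>(a, b). \<beta> a b)"
    by (rule linear_linear_extension[OF V])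
  show ?thesis
    unfolding tsum_def
  proof (rule formal_sums_agree[OF V _ eq[unfolded tensor_eq_def]])
    fix r assume "r \<in> tensor_relations sA sB"
    then show "linear_extension sV (\<lambda>(a, b). \<beta> a b) r = 0"
      unfolding tensor_relations_def
      by (auto simp: L.diff V l1.add l2.add l1.scale l2.scale)
  qed
qed

lemma tsum_tensor3_eq:
  assumes eq: "tensor3_eq sA sB sC s t"
    and l1: "\<And>b c. Vector_Spaces.linear sA sV (\<lambda>a. \<gamma> a b c)"
    and l2: "\<And>a c. Vector_Spaces.linear sB sV (\<lambda>b. \<gamma> a b c)"
    and l3: "\<And>a b. Vector_Spaces.linear sC sV (\<lambda>c. \<gamma> a b c)"
  shows "(\<Sum>(a, b, c)\<leftarrow>s. \<gamma> a b c) = (\<Sum>(a, b, c)\<leftarrow>t. \<gamma> a b c)"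
proof -
  interpret l1: Vector_Spaces.linear sA sV "\<lambda>a. \<gamma> a b c" for b c by (rule l1)
  interpret l2: Vector_Spaces.linear sB sV "\<lambda>b. \<gamma> a b c" for a c by (rule l2)
  interpret l3: Vector_Spaces.linear sC sV "\<lambda>c. \<gamma> a b c" for a b by (rule l3)
  have V: "vector_space sV" by (rule l1.vs2.vector_space_axioms)
  interpret L: Vector_Spaces.linear scale_formal sV "linear_extension sV (\<lambda>(a, b, c). \<gamma> a b c)"
    by (rule linear_linear_extension[OF V])
  show ?thesis
  proof (rule formal_sums_agree[OF V _ eq[unfolded tensor3_eq_def]])
    fix r assume "r \<in> tensor3_relations sA sB sC"
    then show "linear_extension sV (\<lambda>(a, b, c). \<gamma> a b c) r = 0"
      unfolding tensor3_relations_def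
      by (auto simp: L.diff V l1.add l2.add l3.add l1.scale l2.scale l3.scale)
  qed
qed

lemma tsum_simps [simp]:
  "tsum [] \<beta> = 0"
  "tsum ((a, b) # t) \<beta> = \<beta> a b + tsum t \<beta>"
  "tsum (s @ t) \<beta> = tsum s \<beta> + tsum t \<beta>"
  by (simp_all add: tsum_def)

lemma tsum_map_first: "(\<Sum>(a, b, c)\<leftarrow>map_first f t. \<gamma> a b c) = tsum t (\<lambda>a c. tsum (f a) (\<lambda>a b. \<gamma> a b c))"
  by (induction t) (auto simp: map_first_def tsum_def o_def case_prod_unfold)

lemma tsum_map_second: "(\<Sum>(a, b, c)\<leftarrow>map_second f t. \<gamma> a b c) = tsum t (\<lambda>a b. tsum (f b) (\<lambda>b c. \<gamma> a b c))"
  by (induction t) (auto simp: map_second_def tsum_def o_def case_prod_unfold)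

lemma tsum_tensor_mult:
  "tsum (tensor_mult s t) \<beta> = tsum s (\<lambda>a b. tsum t (\<lambda>c d. \<beta> (a * c) (b * d)))"
  by (induction s) (auto simp: tensor_mult_def tsum_def o_def case_prod_unfold)

lemma tsum_zero [simp]: "tsum t (\<lambda>a b. 0) = 0"
  by (induction t) auto

lemma tsum_add: "tsum t (\<lambda>a b. \<beta> a b + \<gamma> a b) = tsum t \<beta> + tsum t \<gamma>"
  by (induction t) (auto simp: algebra_simps)

lemma tsum_swap:
  "tsum s (\<lambda>a b. tsum t (\<lambda>c d. \<beta> a b c d)) = tsum t (\<lambda>c d. tsum s (\<lambda>a b. \<beta> a b c d))"
  by (induction s) (auto simp: tsum_add)

lemma tsum_mult_right: "tsum t \<beta> * (x :: 'c::semiring_0) = tsum t (\<lambda>a b. \<beta> a b * x)"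
  by (induction t) (auto simp: distrib_right)

lemma tsum_mult_left: "(x :: 'c::semiring_0) * tsum t \<beta> = tsum t (\<lambda>a b. x * \<beta> a b)"
  by (induction t) (auto simp: distrib_left)

lemma tsum_sum: "tsum t (\<lambda>a b. \<Sum>i\<in>I. \<beta> i a b) = (\<Sum>i\<in>I. tsum t (\<beta> i))"
  by (induction t) (auto simp: sum.distrib)

lemma tsum_cong: "(\<And>a b. (a, b) \<in> set t \<Longrightarrow> \<beta> a b = \<gamma> a b) \<Longrightarrow> tsum t \<beta> = tsum t \<gamma>"
  by (induction t) auto

lemma tsum_linear:
  assumes "Vector_Spaces.linear sV sW f"
  shows "f (tsum t \<beta>) = tsum t (\<lambda>a b. f (\<beta> a b))"
proof -
  interpret Vector_Spaces.linear sV sW f by fact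
  show ?thesis by (induction t) (auto simp: add zero)
qed

lemma (in module) tsum_in_subspace:
  assumes "subspace W" "\<And>a b. (a, b) \<in> set t \<Longrightarrow> \<beta> a b \<in> W"
  shows "tsum t \<beta> \<in> W"
  using assms(2)
  by (induction t) (auto intro!: subspace_add[OF assms(1)] subspace_0[OF assms(1)])

abbreviation linear_form ::
  "('k::field \<Rightarrow> 'v::ab_group_add \<Rightarrow> 'v) \<Rightarrow> ('v \<Rightarrow> 'k) \<Rightarrow> bool" where
  "linear_form sV \<equiv> Vector_Spaces.linear sV (*)"

context vector_space
begin

lemma linear_scale_form:
  fixes f :: "'b \<Rightarrow> 'a"
  assumes "linear_form scale f" "vector_space sV"
  shows "Vector_Spaces.linear scale sV (\<lambda>a. sV (f a) v)"
proof -
  interpret f: Vector_Spaces.linear scale "(*)" f by fact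
  interpret V: vector_space sV by fact
  show ?thesis
    by (intro Vector_Spaces.linear.intro assms vector_space_axioms module_hom.intro
        module_hom_axioms.intro V.module_axioms module_axioms)
      (auto simp: f.add f.scale V.scale_left_distrib)
qed

lemma linear_form_representation:
  assumes "independent B" "span B = UNIV"
  shows "linear_form scale (\<lambda>v. representation B v e)"
proof -
  interpret K: vector_space "(*) :: 'a \<Rightarrow> 'a \<Rightarrow> 'a"
    by unfold_locales (auto simp: algebra_simps)
  show ?thesis
    by (intro Vector_Spaces.linear.intro vector_space_axioms module_hom.intro K.vector_space_axioms
        module_hom_axioms.intro module_axioms K.module_axioms)
      (use assms in \<open>auto simp: representation_add representation_scale\<close>)
qed

lemma basis_expansion:
  assumes "finite B" "independent B" "span B = UNIV"
  shows "(\<Sum>e\<in>B. scale (representation B v e) e) = v"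
  using sum_representation_eq[of B v B] assms by auto

context
  fixes sB :: "'a \<Rightarrow> 'c::ab_group_add \<Rightarrow> 'c"
  assumes sB: "vector_space sB"
begin

interpretation B: vector_space sB by (rule sB)

abbreviation (input) "rel \<equiv> formal.span (tensor_relations scale sB)"
abbreviation (input) "pure x \<equiv> Poly_Mapping.single x (1 :: 'a)"

lemma pure_add_first: "pure (a + a', b) - (pure (a, b) + pure (a', b)) \<in> rel"
  unfolding diff_diff_eq[symmetric]
  by (rule formal.span_base) (unfold tensor_relations_def, blast)

lemma pure_add_second: "pure (a, b + b') - (pure (a, b) + pure (a, b')) \<in> rel"
  unfolding diff_diff_eq[symmetric]
  by (rule formal.span_base) (unfold tensor_relations_def, blast)

lemma pure_scale: "pure (scale c a, b) - pure (a, sB c b) \<in> rel"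
proof -
  have "pure (scale c a, b) - Poly_Mapping.single (a, b) c \<in> rel"
    by (rule formal.span_base) (unfold tensor_relations_def, blast)
  moreover have "pure (a, sB c b) - Poly_Mapping.single (a, b) c \<in> rel"
    by (rule formal.span_base) (unfold tensor_relations_def, blast)
  ultimately have "pure (scale c a, b) - Poly_Mapping.single (a, b) c
      - (pure (a, sB c b) - Poly_Mapping.single (a, b) c) \<in> rel"
    by (rule formal.span_diff)
  then show ?thesis by simp
qed

lemma pure_zero_first: "pure (0, b) \<in> rel"
  using formal.span_neg[OF pure_add_first[of 0 0 b]] by simp

lemma pure_zero_second: "pure (a, 0) \<in> rel"
  using formal.span_neg[OF pure_add_second[of a 0 0]] by simp

lemma pure_sum_first:
  "finite I \<Longrightarrow> pure (\<Sum>i\<in>I. f i, b) - (\<Sum>i\<in>I. pure (f i, b)) \<in> rel"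
proof (induction rule: finite_induct)
  case empty
  show ?case using pure_zero_first by simp
next
  case (insert i I)
  from formal.span_add[OF pure_add_first[of "f i" "\<Sum>i\<in>I. f i" b] insert.IH] insert.hyps
  show ?case by (simp add: algebra_simps)
qed

lemma formal_sum_normal_form:
  assumes B: "finite B" "independent B" "span B = UNIV"
  shows "formal_sum t - (\<Sum>e\<in>B. pure (e, tsum t (\<lambda>a b. sB (representation B a e) b))) \<in> rel"
proof (induction t)
  case Nil
  show ?case
    by (auto simp: formal_sum_def intro!: formal.span_neg formal.span_sum pure_zero_second)
next
  case (Cons x t)
  obtain a b where x: "x = (a, b)" by (cases x)
  define g where "g e = tsum t (\<lambda>a b. sB (representation B a e) b)" for e
  define r where "r e = representation B a e" for e
  have h1: "pure (a, b) - (\<Sum>e\<in>B. pure (scale (r e) e, b)) \<in> rel"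
    using pure_sum_first[OF B(1), of "\<lambda>e. scale (r e) e" b] by (simp add: basis_expansion[OF B] r_def)
  have h2: "(\<Sum>e\<in>B. pure (scale (r e) e, b)) - (\<Sum>e\<in>B. pure (e, sB (r e) b)) \<in> rel"
    unfolding sum_subtractf[symmetric] by (intro formal.span_sum pure_scale)
  have h3: "(\<Sum>e\<in>B. pure (e, sB (r e) b + g e))
      - ((\<Sum>e\<in>B. pure (e, sB (r e) b)) + (\<Sum>e\<in>B. pure (e, g e))) \<in> rel"
    unfolding sum.distrib[symmetric] sum_subtractf[symmetric]
    by (intro formal.span_sum pure_add_second)
  have "pure (a, b) - (\<Sum>e\<in>B. pure (scale (r e) e, b))
      + ((\<Sum>e\<in>B. pure (scale (r e) e, b)) - (\<Sum>e\<in>B. pure (e, sB (r e) b)))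
      - ((\<Sum>e\<in>B. pure (e, sB (r e) b + g e))
      - ((\<Sum>e\<in>B. pure (e, sB (r e) b)) + (\<Sum>e\<in>B. pure (e, g e))))
      + (formal_sum t - (\<Sum>e\<in>B. pure (e, g e))) \<in> rel" (is "?l \<in> _")
    by (rule formal.span_add[OF formal.span_diff[OF formal.span_add[OF h1 h2] h3]
          Cons.IH[folded g_def]])
  also have "?l = formal_sum (x # t) - (\<Sum>e\<in>B. pure (e, sB (r e) b + g e))"
    by (simp add: formal_sum_def x)
  finally show ?case by (simp add: x g_def r_def)
qed

text \<open>
  Expanding all first legs in a basis brings a tensor into the form \<Sum> e \<otimes> b_e, where b_e is obtained by
  applying the coordinate form of e to the first leg. Two tensors are shown to be equal by comparing the
  coefficients b_e.
\<close>

lemma tensor_eq_normal_form: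
  assumes B: "finite B" "independent B" "span B = UNIV" and "set es = B" "distinct es"
  shows "tensor_eq scale sB t (map (\<lambda>e. (e, tsum t (\<lambda>a b. sB (representation B a e) b))) es)"
  using formal_sum_normal_form[OF B, of t] assms(4,5)
  by (simp add: tensor_eq_def formal_sum_def o_def sum_list_distinct_conv_sum_set)

lemma tensor_eq_trans: "tensor_eq scale sB s t \<Longrightarrow> tensor_eq scale sB t u \<Longrightarrow> tensor_eq scale sB s u"
  unfolding tensor_eq_def
  by (drule (1) formal.span_add) simp

lemma tensor_eq_sym: "tensor_eq scale sB s t \<Longrightarrow> tensor_eq scale sB t s"
  unfolding tensor_eq_def
  by (drule formal.span_neg) simp

text \<open>
  Linear forms on the first leg separate tensors, because the coefficients of the normal form are values
  of coordinate forms.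
\<close>

lemma tensor_eqI:
  assumes B: "finite B" "independent B" "span B = UNIV"
    and eq: "\<And>f. linear_form scale f \<Longrightarrow> tsum s (\<lambda>a b. sB (f a) b) = tsum t (\<lambda>a b. sB (f a) b)"
  shows "tensor_eq scale sB s t"
proof -
  obtain es where es: "set es = B" "distinct es"
    using finite_distinct_list[OF B(1)] by blast
  have "tsum s (\<lambda>a b. sB (representation B a e) b) = tsum t (\<lambda>a b. sB (representation B a e) b)" for e
    by (rule eq[OF linear_form_representation[OF B(2,3)]])
  then have "tensor_eq scale sB s
      (map (\<lambda>e. (e, tsum t (\<lambda>a b. sB (representation B a e) b))) es)"
    using tensor_eq_normal_form[OF B es, of s] by (simp only:)
  from tensor_eq_trans[OF this tensor_eq_sym[OF tensor_eq_normal_form[OF B es]]]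
  show ?thesis .
qed

lemma linear_scale_second: "Vector_Spaces.linear sB sB (sB c)"
  by (intro Vector_Spaces.linear.intro sB module_hom.intro module_hom_axioms.intro B.module_axioms)
    (auto simp: B.scale_right_distrib mult.commute)

lemma in_tensor_UNIV_iff:
  assumes B: "finite B" "independent B" "span B = UNIV" and W: "B.subspace W"
  shows "in_tensor scale sB UNIV W t \<longleftrightarrow> (\<forall>f. linear_form scale f \<longrightarrow> tsum t (\<lambda>a b. sB (f a) b) \<in> W)"
proof safe
  fix f assume "in_tensor scale sB UNIV W t" and f: "linear_form scale f"
  then obtain s where s: "set s \<subseteq> UNIV \<times> W" "tensor_eq scale sB t s"
    by (auto simp: in_tensor_def)
  have "tsum t (\<lambda>a b. sB (f a) b) = tsum s (\<lambda>a b. sB (f a) b)"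
    by (rule tsum_tensor_eq[OF s(2) linear_scale_form[OF f sB] linear_scale_second])
  also have "\<dots> \<in> W"
    using s(1) by (intro B.tsum_in_subspace[OF W] B.subspace_scale[OF W]) auto
  finally show "tsum t (\<lambda>a b. sB (f a) b) \<in> W" .
next
  assume f: "\<forall>f. linear_form scale f \<longrightarrow> tsum t (\<lambda>a b. sB (f a) b) \<in> W"
  obtain es where es: "set es = B" "distinct es"
    using finite_distinct_list[OF B(1)] by blast
  show "in_tensor scale sB UNIV W t"
    unfolding in_tensor_def using f linear_form_representation[OF B(2,3)]
    by (intro exI[of _ "map (\<lambda>e. (e, tsum t (\<lambda>a b. sB (representation B a e) b))) es"]
        conjI tensor_eq_normal_form[OF B es]) auto
qed

end

text \<open>
  For W \<otimes> W one form on either side suffices: expand in a basis that extends a basis C of W. The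
  condition on the first leg puts every coefficient b_e into W, the condition on the second leg makes
  b_e vanish for e outside C.
\<close>

lemma in_tensor_self_iff:
  assumes fd: "finite_dimensional scale" and W: "subspace W"
  shows "in_tensor scale scale W W t \<longleftrightarrow>
    (\<forall>f. linear_form scale f \<longrightarrow> tsum t (\<lambda>a b. scale (f a) b) \<in> W \<and> tsum t (\<lambda>a b. scale (f b) a) \<in> W)"
proof safe
  fix f assume "in_tensor scale scale W W t" and f: "linear_form scale f"
  then obtain s where s: "set s \<subseteq> W \<times> W" "tensor_eq scale scale t s"
    by (auto simp: in_tensor_def)
  note lin = linear_scale_form[OF f vector_space_axioms] linear_scale_second[OF vector_space_axioms]
  have "tsum t (\<lambda>a b. scale (f a) b) = tsum s (\<lambda>a b. scale (f a) b)"
    by (rule tsum_tensor_eq[OF s(2) lin])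
  also have "\<dots> \<in> W"
    using s(1) by (intro tsum_in_subspace[OF W] subspace_scale[OF W]) auto
  finally show "tsum t (\<lambda>a b. scale (f a) b) \<in> W" .
  have "tsum t (\<lambda>a b. scale (f b) a) = tsum s (\<lambda>a b. scale (f b) a)"
    by (rule tsum_tensor_eq[OF s(2) lin(2,1)])
  also have "\<dots> \<in> W"
    using s(1) by (intro tsum_in_subspace[OF W] subspace_scale[OF W]) auto
  finally show "tsum t (\<lambda>a b. scale (f b) a) \<in> W" .
next
  assume f: "\<forall>f. linear_form scale f \<longrightarrow> tsum t (\<lambda>a b. scale (f a) b) \<in> W \<and> tsum t (\<lambda>a b. scale (f b) a) \<in> W"
  obtain C where C: "C \<subseteq> W" "independent C" "W \<subseteq> span C"
    by (rule maximal_independent_subset[of W])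
  obtain B where B: "C \<subseteq> B" "independent B" "span B = UNIV"
    using maximal_independent_subset_extend[OF subset_UNIV C(2)] by (metis top.extremum_unique)
  obtain S where "finite S" "span S = UNIV" using fd by (auto simp: finite_dimensional_def)
  then have "finite B" using independent_span_bound[of S B] B(2) by auto
  obtain es where es: "set es = B" "distinct es"
    using finite_distinct_list[OF \<open>finite B\<close>] by blast
  define g where "g e = tsum t (\<lambda>a b. scale (representation B a e) b)" for e
  \<comment> \<open>Every coordinate of g e is the e-coordinate of a vector of W, hence zero.\<close>
  have g0: "g e = 0" if e: "e \<in> B - C" for e
  proof -
    have "representation B (g e) e' = 0" for e'
    proof -
      define f' where "f' v = representation B v e'" for v
      define v where "v = tsum t (\<lambda>a b. scale (f' b) a)"
      have r: "linear_form scale (\<lambda>v. representation B v e)" for e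
        by (rule linear_form_representation[OF B(2,3)])
      have "v \<in> span C"
        using f[rule_format, OF r, THEN conjunct2] C(3) unfolding v_def f'_def by (rule set_mp[rotated])
      then have "representation B v = representation C v"
        by (intro representation_extend B)
      moreover have "representation C v e = 0"
        using representation_ne_zero[of C v e] e by auto
      moreover have "representation B v e = f' (g e)"
        unfolding v_def g_def f'_def tsum_linear[OF r]
        by (simp add: B representation_scale mult.commute)
      ultimately show ?thesis by (simp add: f'_def)
    qed
    then show ?thesis
      using basis_expansion[OF \<open>finite B\<close> B(2,3), of "g e"] by (simp del: sum_representation_eq)
  qed
  define n where "n = map (\<lambda>e. (e, g e)) es"
  define s where "s = map (\<lambda>e. (e, g e)) (filter (\<lambda>e. e \<in> C) es)"
  have "tensor_eq scale scale t n"
    unfolding n_def g_def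
    by (rule tensor_eq_normal_form[OF vector_space_axioms \<open>finite B\<close> B(2,3) es])
  moreover have "tensor_eq scale scale n s"
  proof (rule tensor_eqI[OF vector_space_axioms \<open>finite B\<close> B(2,3)])
    fix f
    have "set xs \<subseteq> B \<Longrightarrow> tsum (map (\<lambda>e. (e, g e)) xs) (\<lambda>a b. scale (f a) b)
      = tsum (map (\<lambda>e. (e, g e)) (filter (\<lambda>e. e \<in> C) xs)) (\<lambda>a b. scale (f a) b)" for xs
      by (induction xs) (auto simp: g0)
    from this[of es] show "tsum n (\<lambda>a b. scale (f a) b) = tsum s (\<lambda>a b. scale (f a) b)"
      by (simp add: n_def s_def es)
  qed
  ultimately have "tensor_eq scale scale t s"
    by (rule tensor_eq_trans[OF vector_space_axioms])
  moreover have "set s \<subseteq> W \<times> W"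
  proof -
    have "g e \<in> W" for e
      unfolding g_def using f[rule_format, OF linear_form_representation[OF B(2,3)]] by (rule conjunct1)
    then show ?thesis using C(1) by (auto simp: s_def)
  qed
  ultimately show "in_tensor scale scale W W t"
    unfolding in_tensor_def by (intro exI[of _ s] conjI)
qed

end


section \<open>Sweedler calculus\<close>

text \<open>
  Linear endomorphisms, linear forms and bilinear maps of a single space. The rules below are syntax
  directed, so that multilinearity of an expression with several legs is proved automatically.
\<close>

locale scalar_space = vector_space scale
  for scale :: "'k::field \<Rightarrow> 'h::ab_group_add \<Rightarrow> 'h"
begin

abbreviation lin :: "('h \<Rightarrow> 'h) \<Rightarrow> bool" where
  "lin \<equiv> Vector_Spaces.linear scale scale"

definition bilin :: "('h \<Rightarrow> 'h \<Rightarrow> 'h) \<Rightarrow> bool" where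
  "bilin \<beta> \<longleftrightarrow> (\<forall>b. lin (\<lambda>a. \<beta> a b)) \<and> (\<forall>a. lin (\<lambda>b. \<beta> a b))"

lemma linI:
  "(\<And>x y. f (x + y) = f x + f y) \<Longrightarrow> (\<And>c x. f (scale c x) = scale c (f x)) \<Longrightarrow> lin f"
  by (intro Vector_Spaces.linear.intro vector_space_axioms module_hom.intro module_hom_axioms.intro
      module_axioms)

lemma formI:
  fixes f :: "'h \<Rightarrow> 'k"
  assumes "\<And>x y. f (x + y) = f x + f y" "\<And>c x. f (scale c x) = c * f x"
  shows "linear_form scale f"
proof -
  interpret K: vector_space "(*) :: 'k \<Rightarrow> 'k \<Rightarrow> 'k"
    by unfold_locales (auto simp: algebra_simps)
  show ?thesis
    by (intro Vector_Spaces.linear.intro vector_space_axioms module_hom.intro K.vector_space_axioms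
        module_hom_axioms.intro module_axioms K.module_axioms assms)
qed

lemma lin_addD: "lin f \<Longrightarrow> f (x + y) = f x + f y"
  and lin_scaleD: "lin f \<Longrightarrow> f (scale c x) = scale c (f x)"
  and lin_zeroD: "lin f \<Longrightarrow> f 0 = 0"
  by (simp_all add: Vector_Spaces.linear_iff_module_hom module_hom.add module_hom.scale module_hom.zero)

lemma form_addD: "linear_form scale \<phi> \<Longrightarrow> \<phi> (x + y) = \<phi> x + \<phi> y"
  and form_scaleD: "linear_form scale \<phi> \<Longrightarrow> \<phi> (scale c x) = c * \<phi> x"
  and form_zeroD: "linear_form scale \<phi> \<Longrightarrow> \<phi> 0 = 0"
  by (simp_all add: Vector_Spaces.linear_iff_module_hom module_hom.add module_hom.scale module_hom.zero)

lemma lin_id: "lin (\<lambda>x. x)"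
  by (rule linI) auto

lemma lin_comp: "lin f \<Longrightarrow> lin g \<Longrightarrow> lin (\<lambda>x. f (g x))"
  by (rule linI) (auto simp: lin_addD lin_scaleD)

lemma form_comp: "linear_form scale \<phi> \<Longrightarrow> lin g \<Longrightarrow> linear_form scale (\<lambda>x. \<phi> (g x))"
  by (rule formI) (auto simp: lin_addD lin_scaleD form_addD form_scaleD)

lemma form_times: "linear_form scale \<phi> \<Longrightarrow> linear_form scale (\<lambda>x. \<phi> x * c)"
  "linear_form scale \<phi> \<Longrightarrow> linear_form scale (\<lambda>x. c * \<phi> x)"
  by (rule formI; auto simp: form_addD form_scaleD algebra_simps)+

lemma lin_form_scale: "linear_form scale \<phi> \<Longrightarrow> lin (\<lambda>x. scale (\<phi> x) v)"
  by (rule linI) (auto simp: form_addD form_scaleD scale_left_distrib)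

lemma lin_scale: "lin f \<Longrightarrow> lin (\<lambda>x. scale c (f x))"
  by (rule linI) (auto simp: lin_addD lin_scaleD scale_right_distrib mult.commute)

lemma lin_tsumD: "lin f \<Longrightarrow> f (tsum t \<beta>) = tsum t (\<lambda>a b. f (\<beta> a b))"
  by (rule tsum_linear)

lemma scale_tsum: "scale c (tsum t \<beta>) = tsum t (\<lambda>a b. scale c (\<beta> a b))"
  by (rule tsum_linear[OF lin_scale[OF lin_id]])

lemma lin_tsum: "(\<And>a b. lin (\<lambda>x. \<beta> x a b)) \<Longrightarrow> lin (\<lambda>x. tsum t (\<lambda>a b. \<beta> x a b))"
  by (rule linI) (simp_all add: lin_addD[where f = "\<lambda>x. \<beta> x _ _"]
      lin_scaleD[where f = "\<lambda>x. \<beta> x _ _"] tsum_add scale_tsum)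

lemma bilinI: "(\<And>b. lin (\<lambda>a. \<beta> a b)) \<Longrightarrow> (\<And>a. lin (\<lambda>b. \<beta> a b)) \<Longrightarrow> bilin \<beta>"
  by (simp add: bilin_def)

lemma bilin_first: "bilin \<beta> \<Longrightarrow> lin g \<Longrightarrow> lin (\<lambda>x. \<beta> (g x) y)"
  and bilin_second: "bilin \<beta> \<Longrightarrow> lin g \<Longrightarrow> lin (\<lambda>x. \<beta> y (g x))"
  unfolding bilin_def using lin_comp by (blast, blast)

lemma tsum_eq_bilin: "tensor_eq scale scale s t \<Longrightarrow> bilin \<beta> \<Longrightarrow> tsum s \<beta> = tsum t \<beta>"
  by (rule tsum_tensor_eq[where sV = scale]) (auto simp: bilin_def)

lemmas lin_intros = lin_id lin_form_scale lin_scale lin_tsum form_times bilinI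

end

sublocale coalgebra \<subseteq> scalar_space scale
  by unfold_locales

context coalgebra
begin

text \<open>
  The expression sw h (\<lambda>a b. \<beta> a b) reads \<beta>(h1, h2) in Sweedler notation; further legs are obtained by
  nesting.
\<close>

abbreviation sw :: "'h \<Rightarrow> ('h \<Rightarrow> 'h \<Rightarrow> 'h) \<Rightarrow> 'h" where
  "sw h \<beta> \<equiv> tsum (comult h) \<beta>"

lemma form_counit: "lin g \<Longrightarrow> linear_form scale (\<lambda>x. counit (g x))"
  by (rule form_comp[OF counit_linear])

lemma tsum_scale_first:
  "tsum [(scale c a, b). (a, b) \<leftarrow> t] \<beta> = tsum t (\<lambda>a b. \<beta> (scale c a) b)"
  by (induction t) auto

lemma lin_sw:
  assumes "lin g" "bilin \<beta>"
  shows "lin (\<lambda>x. sw (g x) \<beta>)"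
proof (rule linI)
  have b: "\<beta> (scale c a) b = scale c (\<beta> a b)" for c a b
    using assms(2) lin_scaleD[where f = "\<lambda>a. \<beta> a b"] by (simp add: bilin_def)
  show "sw (g (x + y)) \<beta> = sw (g x) \<beta> + sw (g y) \<beta>" for x y
    using tsum_eq_bilin[OF _ assms(2), of "comult (g x + g y)" "comult (g x) @ comult (g y)"]
      comult_linear
    by (simp add: lin_addD[OF assms(1)] linear_to_tensor_def)
  show "sw (g (scale c x)) \<beta> = scale c (sw (g x) \<beta>)" for c x
    using tsum_eq_bilin[OF _ assms(2), of "comult (scale c (g x))"
        "[(scale c a, b). (a, b) \<leftarrow> comult (g x)]"] comult_linear
    by (simp add: lin_scaleD[OF assms(1)] linear_to_tensor_def tsum_scale_first scale_tsum b)
qed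

lemmas sw_intros = lin_intros lin_sw form_counit

lemma sw_coassoc:
  assumes "\<And>b c. lin (\<lambda>a. \<gamma> a b c)" "\<And>a c. lin (\<lambda>b. \<gamma> a b c)" "\<And>a b. lin (\<lambda>c. \<gamma> a b c)"
  shows "sw h (\<lambda>a c. sw a (\<lambda>a b. \<gamma> a b c)) = sw h (\<lambda>a b. sw b (\<lambda>b c. \<gamma> a b c))"
  using tsum_tensor3_eq[OF coassoc assms, of h]
  by (simp add: tsum_map_first tsum_map_second)

lemma sw_counit_left:
  assumes "lin f" shows "sw h (\<lambda>a b. scale (counit a) (f b)) = f h"
  using tsum_linear[OF assms, of "comult h" "\<lambda>a b. scale (counit a) b"] counit_left[of h]
  by (simp add: tsum_def lin_scaleD[OF assms])

lemma sw_counit_right: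
  assumes "lin f" shows "sw h (\<lambda>a b. scale (counit b) (f a)) = f h"
  using tsum_linear[OF assms, of "comult h" "\<lambda>a b. scale (counit b) a"] counit_right[of h]
  by (simp add: tsum_def lin_scaleD[OF assms])

end

context hopf_algebra
begin

lemma lin_mult: "lin f \<Longrightarrow> lin (\<lambda>x. f x * c)" "lin f \<Longrightarrow> lin (\<lambda>x. c * f x)"
  by (rule linI; simp add: lin_addD lin_scaleD algebra_simps scale_mult_left scale_mult_right)+

lemma lin_antipode: "lin f \<Longrightarrow> lin (\<lambda>x. antipode (f x))"
  by (rule lin_comp[OF antipode_linear])

lemmas hopf_intros = sw_intros lin_mult lin_antipode

lemma sw_mult: "bilin \<beta> \<Longrightarrow> sw (x * y) \<beta> = sw x (\<lambda>a b. sw y (\<lambda>c d. \<beta> (a * c) (b * d)))"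
  using tsum_eq_bilin[OF comult_mult] by (simp add: tsum_tensor_mult)

lemma sw_one: "bilin \<beta> \<Longrightarrow> sw 1 \<beta> = \<beta> 1 1"
  using tsum_eq_bilin[OF comult_one] by simp

lemma sw_antipode_left:
  assumes "lin f" shows "sw h (\<lambda>a b. f (antipode a * b)) = scale (counit h) (f 1)"
  using tsum_linear[OF assms, of "comult h" "\<lambda>a b. antipode a * b"] antipode_left[of h]
  by (simp add: tsum_def lin_scaleD[OF assms])

lemma sw_antipode_right:
  assumes "lin f" shows "sw h (\<lambda>a b. f (a * antipode b)) = scale (counit h) (f 1)"
  using tsum_linear[OF assms, of "comult h" "\<lambda>a b. a * antipode b"] antipode_right[of h]
  by (simp add: tsum_def lin_scaleD[OF assms])

lemma antipode_one: "antipode 1 = 1"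
  using antipode_left[of 1, folded tsum_def] sw_one[of "\<lambda>a b. antipode a * b"]
  by (simp add: counit_one hopf_intros)

lemma counit_antipode [simp]: "counit (antipode h) = counit h"
proof -
  have "scale (counit (antipode h)) 1 = sw h (\<lambda>a b. scale (counit b) (scale (counit (antipode a)) 1))"
    by (rule sw_counit_right[symmetric]) (intro hopf_intros)
  also have "\<dots> = sw h (\<lambda>a b. scale (counit (antipode a * b)) 1)"
    by (simp add: counit_mult mult.commute)
  also have "\<dots> = scale (counit h) (scale (counit 1) 1)"
    by (rule sw_antipode_left) (intro hopf_intros)
  finally show ?thesis by (simp add: counit_one)
qed

text \<open>
  Both S(xy) and S(y) S(x) are convolution inverses of the multiplication. In Sweedler notation, the
  expression S(x1 y1) x2 y2 S(y3) S(x3) collapses to either side, depending on which legs are contracted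
  first.
\<close>

lemma antipode_mult: "antipode (x * y) = antipode y * antipode x"
proof -
  let ?\<gamma> = "\<lambda>x1 x2 x3 y1 y2 y3. antipode (x1 * y1) * (x2 * y2 * (antipode y3 * antipode x3))"
  have "sw x (\<lambda>x1 x'. sw x' (\<lambda>x2 x3. sw y (\<lambda>y1 y'. sw y' (\<lambda>y2 y3. ?\<gamma> x1 x2 x3 y1 y2 y3))))
    = sw x (\<lambda>x1 x'. sw x' (\<lambda>x2 x3. sw y (\<lambda>y1 y'. scale (counit y') (antipode (x1 * y1) * (x2 * antipode x3)))))"
    using sw_antipode_right[where f = "\<lambda>z. p * (q * z * r)" for p q r]
    by (simp add: hopf_intros mult.assoc)
  also have "\<dots> = sw x (\<lambda>x1 x'. sw x' (\<lambda>x2 x3. antipode (x1 * y) * (x2 * antipode x3)))"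
    by (simp add: hopf_intros sw_counit_right)
  also have "\<dots> = sw x (\<lambda>x1 x'. scale (counit x') (antipode (x1 * y)))"
    using sw_antipode_right[where f = "\<lambda>z. p * z" for p] by (simp add: hopf_intros)
  also have "\<dots> = antipode (x * y)"
    by (simp add: hopf_intros sw_counit_right)
  finally have 1: "antipode (x * y) =
    sw x (\<lambda>x1 x'. sw x' (\<lambda>x2 x3. sw y (\<lambda>y1 y'. sw y' (\<lambda>y2 y3. ?\<gamma> x1 x2 x3 y1 y2 y3))))" ..
  have "\<dots> = sw x (\<lambda>x1 x'. sw x' (\<lambda>x2 x3. sw y (\<lambda>y' y3. sw y' (\<lambda>y1 y2. ?\<gamma> x1 x2 x3 y1 y2 y3))))"
    by (subst sw_coassoc; (intro hopf_intros | simp))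
  also have "\<dots> = sw x (\<lambda>x' x3. sw x' (\<lambda>x1 x2. sw y (\<lambda>y' y3. sw y' (\<lambda>y1 y2. ?\<gamma> x1 x2 x3 y1 y2 y3))))"
    by (rule sw_coassoc[symmetric]; intro hopf_intros)
  also have "\<dots> = sw x (\<lambda>x' x3. sw y (\<lambda>y' y3. sw x' (\<lambda>x1 x2. sw y' (\<lambda>y1 y2. ?\<gamma> x1 x2 x3 y1 y2 y3))))"
    by (subst tsum_swap) simp
  also have "\<dots> = sw x (\<lambda>x' x3. sw y (\<lambda>y' y3. scale (counit (x' * y')) (antipode y3 * antipode x3)))"
  proof -
    have "sw x' (\<lambda>x1 x2. sw y' (\<lambda>y1 y2. antipode (x1 * y1) * (x2 * y2 * r))) = scale (counit (x' * y')) r"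
      for x' y' r
      using sw_mult[of "\<lambda>p q. antipode p * (q * r)" x' y'] sw_antipode_left[of "\<lambda>z. z * r" "x' * y'"]
      by (simp add: hopf_intros mult.assoc)
    then show ?thesis by simp
  qed
  also have "\<dots> = antipode y * antipode x"
    by (simp add: counit_mult sw_counit_left hopf_intros scale_scale[symmetric] scale_tsum[symmetric] del: scale_scale)
  finally show ?thesis using 1 by simp
qed

end


section \<open>Antipode and adjoint action\<close>

context hopf_algebra
begin

lemma sw_coassoc4:
  assumes "\<And>b c d. lin (\<lambda>a. T a b c d)" "\<And>a c d. lin (\<lambda>b. T a b c d)"
    "\<And>a b d. lin (\<lambda>c. T a b c d)" "\<And>a b c. lin (\<lambda>d. T a b c d)"
  shows "sw h (\<lambda>x y. sw x (\<lambda>a b. sw y (\<lambda>c d. T a b c d)))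
    = sw h (\<lambda>x d. sw x (\<lambda>a y. sw y (\<lambda>b c. T a b c d)))"
proof -
  have "sw h (\<lambda>x y. sw x (\<lambda>a b. sw y (\<lambda>c d. T a b c d)))
      = sw h (\<lambda>x y. sw y (\<lambda>c d. sw x (\<lambda>a b. T a b c d)))"
    by (subst tsum_swap) simp
  also have "\<dots> = sw h (\<lambda>y d. sw y (\<lambda>x c. sw x (\<lambda>a b. T a b c d)))"
    by (rule sw_coassoc[symmetric]; intro hopf_intros assms)
  also have "\<dots> = sw h (\<lambda>y d. sw y (\<lambda>a x. sw x (\<lambda>b c. T a b c d)))"
    by (subst sw_coassoc[where \<gamma> = "\<lambda>a b c. T a b c d" for d]; intro hopf_intros assms refl)
  finally show ?thesis .
qed

text \<open>
  The same argument in the algebra H \<otimes> H: the product \<Delta>(S(h1)) \<Delta>(h2) (S(h4) \<otimes> S(h3)) collapses from the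
  right to \<Delta>(S(h)) and from the left to S(h2) \<otimes> S(h1).
\<close>

lemma comult_antipode:
  assumes \<beta>: "bilin \<beta>"
  shows "sw (antipode h) \<beta> = sw h (\<lambda>a b. \<beta> (antipode b) (antipode a))"
proof -
  note intros = hopf_intros bilin_first[OF \<beta>] bilin_second[OF \<beta>]
  have F: "sw h' (\<lambda>h2 h''. sw h'' (\<lambda>h3 h4. sw h2 (\<lambda>c d.
      \<beta> (p * (c * antipode h4)) (q * (d * antipode h3))))) = scale (counit h') (\<beta> p q)" for p q h'
  proof -
    have "sw h' (\<lambda>h2 h''. sw h'' (\<lambda>h3 h4. sw h2 (\<lambda>c d.
        \<beta> (p * (c * antipode h4)) (q * (d * antipode h3)))))
      = sw h' (\<lambda>h2 h''. sw h2 (\<lambda>c d. sw h'' (\<lambda>h3 h4.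
        \<beta> (p * (c * antipode h4)) (q * (d * antipode h3)))))"
      by (subst tsum_swap) simp
    also have "\<dots> = sw h' (\<lambda>c k. sw k (\<lambda>d h''. sw h'' (\<lambda>h3 h4.
        \<beta> (p * (c * antipode h4)) (q * (d * antipode h3)))))"
      by (rule sw_coassoc; intro intros)
    also have "\<dots> = sw h' (\<lambda>c k. sw k (\<lambda>k' h4. sw k' (\<lambda>d h3.
        \<beta> (p * (c * antipode h4)) (q * (d * antipode h3)))))"
      by (subst sw_coassoc[symmetric]; (intro intros | simp))
    also have "\<dots> = sw h' (\<lambda>c k. sw k (\<lambda>k' h4. scale (counit k') (\<beta> (p * (c * antipode h4)) q)))"
      using sw_antipode_right[where f = "\<lambda>z. \<beta> r (q * z)" for r] by (simp add: intros)
    also have "\<dots> = sw h' (\<lambda>c k. \<beta> (p * (c * antipode k)) q)"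
      by (subst sw_counit_left; (intro intros | simp))
    also have "\<dots> = scale (counit h') (\<beta> p q)"
      using sw_antipode_right[where f = "\<lambda>z. \<beta> (p * z) q"] by (simp add: intros)
    finally show ?thesis .
  qed
  let ?E = "\<lambda>h1 h2 h3 h4. sw (antipode h1) (\<lambda>p q. sw h2 (\<lambda>c d.
      \<beta> (p * (c * antipode h4)) (q * (d * antipode h3))))"
  have "sw (antipode h) \<beta> = sw h (\<lambda>h1 h'. scale (counit h') (sw (antipode h1) \<beta>))"
    by (rule sw_counit_right[symmetric]) (intro intros lin_sw \<beta>)
  also have "\<dots> = sw h (\<lambda>h1 h'. sw (antipode h1) (\<lambda>p q. sw h' (\<lambda>h2 h''. sw h'' (\<lambda>h3 h4. sw h2 (\<lambda>c d.
      \<beta> (p * (c * antipode h4)) (q * (d * antipode h3)))))))"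
    by (simp add: F scale_tsum)
  also have "\<dots> = sw h (\<lambda>h1 h'. sw h' (\<lambda>h2 h''. sw h'' (\<lambda>h3 h4. ?E h1 h2 h3 h4)))"
    by (subst tsum_swap, subst (2) tsum_swap) simp
  also have "\<dots> = sw h (\<lambda>k h''. sw k (\<lambda>h1 h2. sw h'' (\<lambda>h3 h4. ?E h1 h2 h3 h4)))"
    by (rule sw_coassoc[symmetric]; intro intros)
  also have "\<dots> = sw h (\<lambda>k h''. sw h'' (\<lambda>h3 h4. sw k (\<lambda>h1 h2. ?E h1 h2 h3 h4)))"
    by (subst tsum_swap) simp
  also have "\<dots> = sw h (\<lambda>k h''. sw h'' (\<lambda>h3 h4. scale (counit k) (\<beta> (antipode h4) (antipode h3))))"
  proof -
    have "sw k (\<lambda>h1 h2. ?E h1 h2 h3 h4) = scale (counit k) (\<beta> (antipode h4) (antipode h3))" for k h3 h4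
    proof -
      have b: "bilin (\<lambda>p q. \<beta> (p * antipode h4) (q * antipode h3))" by (intro intros)
      have "sw k (\<lambda>h1 h2. ?E h1 h2 h3 h4)
          = sw k (\<lambda>h1 h2. sw (antipode h1 * h2) (\<lambda>p q. \<beta> (p * antipode h4) (q * antipode h3)))"
        by (simp add: sw_mult[OF b] mult.assoc)
      also have "\<dots> = scale (counit k) (sw 1 (\<lambda>p q. \<beta> (p * antipode h4) (q * antipode h3)))"
        by (rule sw_antipode_left) (intro intros lin_sw b)
      finally show ?thesis by (simp add: sw_one[OF b])
    qed
    then show ?thesis by simp
  qed
  also have "\<dots> = sw h (\<lambda>a b. \<beta> (antipode b) (antipode a))"
    using sw_counit_left[where f = "\<lambda>z. sw z (\<lambda>h3 h4. \<beta> (antipode h4) (antipode h3))"]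
    by (simp add: intros scale_tsum[symmetric])
  finally show ?thesis .
qed

abbreviation ad :: "'h \<Rightarrow> 'h \<Rightarrow> 'h" where
  "ad \<equiv> adjoint_action comult antipode"

lemma ad_sw: "ad h a = sw h (\<lambda>h1 h2. h1 * a * antipode h2)"
  by (simp add: adjoint_action_def tsum_def)

lemma lin_ad_first: "lin f \<Longrightarrow> lin (\<lambda>x. ad (f x) a)"
  unfolding ad_sw by (intro hopf_intros)

lemma lin_ad_second: "lin f \<Longrightarrow> lin (\<lambda>x. ad h (f x))"
  unfolding ad_sw by (intro hopf_intros)

lemmas ad_intros = hopf_intros lin_ad_first lin_ad_second

lemma ad_one: "ad 1 a = a"
  unfolding ad_sw by (simp add: sw_one hopf_intros antipode_one)

lemma ad_mult: "ad (g * h) a = ad g (ad h a)"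
  unfolding ad_sw
  by (simp add: sw_mult hopf_intros antipode_mult tsum_mult_left tsum_mult_right mult.assoc)

lemma counit_ad: "counit (ad h a) = counit h * counit a"
proof -
  have "scale (counit (ad h a)) 1 = sw h (\<lambda>h1 h2. scale (counit (h1 * a * antipode h2)) 1)"
    unfolding ad_sw by (rule lin_tsumD) (intro hopf_intros lin_id)
  also have "\<dots> = sw h (\<lambda>h1 h2. scale (counit h1) (scale (counit a * counit h2) 1))"
    by (simp add: counit_mult mult.assoc)
  also have "\<dots> = scale (counit a * counit h) 1"
    by (rule sw_counit_left) (intro hopf_intros)
  finally show ?thesis by (simp add: mult.commute)
qed

text \<open>
  The Yetter-Drinfeld compatibility of the adjoint action with the coaction \<Delta>.
\<close>

lemma comult_ad:
  assumes \<beta>: "bilin \<beta>"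
  shows "sw (ad h v) \<beta> = sw h (\<lambda>x h3. sw x (\<lambda>h1 h2. sw v (\<lambda>a w. \<beta> (h1 * a * antipode h3) (ad h2 w))))"
proof -
  note intros = hopf_intros bilin_first[OF \<beta>] bilin_second[OF \<beta>]
  have "sw (ad h v) \<beta> = sw h (\<lambda>x y. sw (x * v * antipode y) \<beta>)"
    unfolding ad_sw by (rule lin_tsumD[where f = "\<lambda>z. sw z \<beta>"]) (intro intros lin_sw \<beta>)
  also have "\<dots> = sw h (\<lambda>x y. sw x (\<lambda>x1 x2. sw v (\<lambda>a w. sw y (\<lambda>y1 y2. \<beta> (x1 * a * antipode y2) (x2 * w * antipode y1)))))"
    by (simp add: sw_mult \<beta> intros comult_antipode)
  also have "\<dots> = sw h (\<lambda>x y. sw x (\<lambda>x1 x2. sw y (\<lambda>y1 y2. sw v (\<lambda>a w. \<beta> (x1 * a * antipode y2) (x2 * w * antipode y1)))))"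
    by (subst (3) tsum_swap) simp
  also have "\<dots> = sw h (\<lambda>x y2. sw x (\<lambda>x1 z. sw z (\<lambda>x2 y1. sw v (\<lambda>a w. \<beta> (x1 * a * antipode y2) (x2 * w * antipode y1)))))"
    by (rule sw_coassoc4; intro intros)
  also have "\<dots> = sw h (\<lambda>x y2. sw x (\<lambda>x1 z. sw v (\<lambda>a w. sw z (\<lambda>x2 y1. \<beta> (x1 * a * antipode y2) (x2 * w * antipode y1)))))"
    by (subst (3) tsum_swap) simp
  also have "\<dots> = sw h (\<lambda>x h3. sw x (\<lambda>h1 h2. sw v (\<lambda>a w. \<beta> (h1 * a * antipode h3) (ad h2 w))))"
    unfolding ad_sw
    by (subst lin_tsumD[where f = "\<lambda>z. \<beta> r z" for r]; (intro intros | simp))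
  finally show ?thesis .
qed

end


section \<open>The R-matrix and the transmuted coproduct\<close>

context quasitriangular_hopf_algebra
begin

abbreviation sR :: "('h \<Rightarrow> 'h \<Rightarrow> 'h) \<Rightarrow> 'h" where
  "sR \<equiv> tsum R"

lemma R_flip:
  assumes "bilin \<beta>"
  shows "sR (\<lambda>r t. sw h (\<lambda>a b. \<beta> (r * a) (t * b))) = sR (\<lambda>r t. sw h (\<lambda>a b. \<beta> (b * r) (a * t)))"
proof -
  have sw: "tsum [(b, a). (a, b) \<leftarrow> t] \<gamma> = tsum t (\<lambda>a b. \<gamma> b a)" for t and \<gamma> :: "'h \<Rightarrow> 'h \<Rightarrow> 'h"
    by (induction t) auto
  have "sR (\<lambda>r t. sw h (\<lambda>a b. \<beta> (r * a) (t * b))) = sw h (\<lambda>a b. sR (\<lambda>r t. \<beta> (b * r) (a * t)))"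
    using tsum_eq_bilin[OF R_comult assms, of h] by (simp add: tsum_tensor_mult sw)
  then show ?thesis by (subst tsum_swap)
qed

lemma R_comult_first:
  assumes "\<And>b c. lin (\<lambda>a. \<gamma> a b c)" "\<And>a c. lin (\<lambda>b. \<gamma> a b c)" "\<And>a b. lin (\<lambda>c. \<gamma> a b c)"
  shows "sR (\<lambda>r t. sw r (\<lambda>a b. \<gamma> a b t)) = sR (\<lambda>r t. sR (\<lambda>r' t'. \<gamma> r r' (t * t')))"
proof -
  have "(\<Sum>(a, b, c)\<leftarrow>tensor3_mult (leg13 s) (leg23 u). \<gamma> a b c)
      = tsum s (\<lambda>r t. tsum u (\<lambda>r' t'. \<gamma> r r' (t * t')))" for s u :: "('h \<times> 'h) list"
    by (induction s) (auto simp: tensor3_mult_def leg13_def leg23_def tsum_def o_def case_prod_unfold)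
  then show ?thesis
    using tsum_tensor3_eq[OF comult_first_R assms] by (simp add: tsum_map_first)
qed

lemma R_comult_second:
  assumes "\<And>b c. lin (\<lambda>a. \<gamma> a b c)" "\<And>a c. lin (\<lambda>b. \<gamma> a b c)" "\<And>a b. lin (\<lambda>c. \<gamma> a b c)"
  shows "sR (\<lambda>r t. sw t (\<lambda>a b. \<gamma> r a b)) = sR (\<lambda>r t. sR (\<lambda>r' t'. \<gamma> (r * r') t' t))"
proof -
  have "(\<Sum>(a, b, c)\<leftarrow>tensor3_mult (leg13 s) (leg12 u). \<gamma> a b c)
      = tsum s (\<lambda>r t. tsum u (\<lambda>r' t'. \<gamma> (r * r') t' t))" for s u :: "('h \<times> 'h) list"
    by (induction s) (auto simp: tensor3_mult_def leg13_def leg12_def tsum_def o_def case_prod_unfold)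
  then show ?thesis
    using tsum_tensor3_eq[OF comult_second_R assms] by (simp add: tsum_map_second)
qed

lemma R_right_inverse:
  "\<exists>Q. \<forall>\<beta>. bilin \<beta> \<longrightarrow> sR (\<lambda>r t. tsum Q (\<lambda>q u. \<beta> (r * q) (t * u))) = \<beta> 1 1"
proof -
  obtain Q where "tensor_eq scale scale (tensor_mult R Q) [(1, 1)]" using R_invertible by blast
  with tsum_eq_bilin[OF this] have
    "\<forall>\<beta>. bilin \<beta> \<longrightarrow> sR (\<lambda>r t. tsum Q (\<lambda>q u. \<beta> (r * q) (t * u))) = \<beta> 1 1"
    by (simp add: tsum_tensor_mult)
  then show ?thesis ..
qed

text \<open>
  Applying the counit to the first leg of (\<Delta> \<otimes> id)(R) = R13 R23 shows that E = (\<epsilon> \<otimes> id)(R) satisfies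
  (1 \<otimes> E) R = R, and R can be cancelled.
\<close>

lemma R_counit_first: "sR (\<lambda>r t. scale (counit r) t) = 1" (is "?E = 1")
proof -
  obtain Q where Q: "\<And>\<beta>. bilin \<beta> \<Longrightarrow> sR (\<lambda>r t. tsum Q (\<lambda>q u. \<beta> (r * q) (t * u))) = \<beta> 1 1"
    using R_right_inverse by blast
  have R: "sR \<beta> = sR (\<lambda>r t. \<beta> r (?E * t))" if \<beta>: "bilin \<beta>" for \<beta>
  proof -
    note intros = hopf_intros bilin_first[OF \<beta>] bilin_second[OF \<beta>]
    have "sR \<beta> = sR (\<lambda>r t. sw r (\<lambda>a b. scale (counit a) (\<beta> b t)))"
      by (simp add: sw_counit_left intros)
    also have "\<dots> = sR (\<lambda>r t. sR (\<lambda>r' t'. scale (counit r) (\<beta> r' (t * t'))))"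
      by (rule R_comult_first; intro intros)
    also have "\<dots> = sR (\<lambda>r' t'. sR (\<lambda>r t. scale (counit r) (\<beta> r' (t * t'))))"
      by (rule tsum_swap)
    also have "\<dots> = sR (\<lambda>r t. \<beta> r (?E * t))"
      by (simp add: tsum_mult_right scale_mult_left intros
          lin_tsumD[where f = "\<lambda>z. \<beta> r z" for r] lin_scaleD[where f = "\<lambda>z. \<beta> r z" for r])
    finally show ?thesis .
  qed
  let ?\<beta> = "\<lambda>a b. scale (counit a) b"
  have "bilin ?\<beta>" by (intro hopf_intros)
  have "1 = sR (\<lambda>r t. tsum Q (\<lambda>q u. ?\<beta> (r * q) (t * u)))"
    using Q[of ?\<beta>] by (simp add: hopf_intros counit_one)
  also have "\<dots> = sR (\<lambda>r t. tsum Q (\<lambda>q u. ?\<beta> (r * q) (?E * (t * u))))"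
    using R[of "\<lambda>r t. tsum Q (\<lambda>q u. ?\<beta> (r * q) (t * u))"] by (simp add: hopf_intros mult.assoc)
  also have "\<dots> = ?E"
    using Q[of "\<lambda>a b. ?\<beta> a (?E * b)"] by (simp add: hopf_intros counit_one)
  finally show ?thesis by simp
qed

lemma R_counit_second: "sR (\<lambda>r t. scale (counit t) r) = 1" (is "?E = 1")
proof -
  obtain Q where Q: "\<And>\<beta>. bilin \<beta> \<Longrightarrow> sR (\<lambda>r t. tsum Q (\<lambda>q u. \<beta> (r * q) (t * u))) = \<beta> 1 1"
    using R_right_inverse by blast
  have R: "sR \<beta> = sR (\<lambda>r t. \<beta> (?E * r) t)" if \<beta>: "bilin \<beta>" for \<beta>
  proof -
    note intros = hopf_intros bilin_first[OF \<beta>] bilin_second[OF \<beta>]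
    have "sR \<beta> = sR (\<lambda>r t. sw t (\<lambda>a b. scale (counit b) (\<beta> r a)))"
      by (simp add: sw_counit_right intros)
    also have "\<dots> = sR (\<lambda>r t. sR (\<lambda>r' t'. scale (counit t) (\<beta> (r * r') t')))"
      by (rule R_comult_second; intro intros)
    also have "\<dots> = sR (\<lambda>r' t'. sR (\<lambda>r t. scale (counit t) (\<beta> (r * r') t')))"
      by (rule tsum_swap)
    also have "\<dots> = sR (\<lambda>r t. \<beta> (?E * r) t)"
      by (simp add: tsum_mult_right scale_mult_left intros
          lin_tsumD[where f = "\<lambda>z. \<beta> z r" for r] lin_scaleD[where f = "\<lambda>z. \<beta> z r" for r])
    finally show ?thesis .
  qed
  let ?\<beta> = "\<lambda>a b. scale (counit b) a"
  have "1 = sR (\<lambda>r t. tsum Q (\<lambda>q u. ?\<beta> (r * q) (t * u)))"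
    using Q[of ?\<beta>] by (simp add: hopf_intros counit_one)
  also have "\<dots> = sR (\<lambda>r t. tsum Q (\<lambda>q u. ?\<beta> (?E * (r * q)) (t * u)))"
    using R[of "\<lambda>r t. tsum Q (\<lambda>q u. ?\<beta> (r * q) (t * u))"] by (simp add: hopf_intros mult.assoc)
  also have "\<dots> = ?E"
    using Q[of "\<lambda>a b. ?\<beta> (?E * a) b"] by (simp add: hopf_intros counit_one)
  finally show ?thesis by simp
qed

text \<open>
  The identity (S \<otimes> id)(R) R = 1 \<otimes> 1: contract the first two legs of (\<Delta> \<otimes> id)(R) = R13 R23 by
  S(a) b.
\<close>

lemma R_antipode_left_inverse:
  assumes \<beta>: "bilin \<beta>"
  shows "sR (\<lambda>r t. sR (\<lambda>r' t'. \<beta> (antipode r * r') (t * t'))) = \<beta> 1 1"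
proof -
  note intros = hopf_intros bilin_first[OF \<beta>] bilin_second[OF \<beta>]
  have "sR (\<lambda>r t. sR (\<lambda>r' t'. \<beta> (antipode r * r') (t * t')))
      = sR (\<lambda>r t. sw r (\<lambda>a b. \<beta> (antipode a * b) t))"
    by (rule R_comult_first[symmetric]; intro intros)
  also have "\<dots> = sR (\<lambda>r t. scale (counit r) (\<beta> 1 t))"
    using sw_antipode_left[where f = "\<lambda>z. \<beta> z t" for t] by (simp add: intros)
  also have "\<dots> = \<beta> 1 (sR (\<lambda>r t. scale (counit r) t))"
    by (simp add: intros
          lin_tsumD[where f = "\<lambda>z. \<beta> r z" for r] lin_scaleD[where f = "\<lambda>z. \<beta> r z" for r])
  finally show ?thesis by (simp add: R_counit_first)
qed

text \<open>
  The identity (S \<otimes> S)(R) = R: by (id \<otimes> \<Delta>)(R) = R13 R12 the element (S \<otimes> S)(R) is a left inverse of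
  (S \<otimes> id)(R), which in turn is a left inverse of R.
\<close>

lemma R_antipode_antipode:
  assumes \<beta>: "bilin \<beta>"
  shows "sR (\<lambda>r t. \<beta> (antipode r) (antipode t)) = sR \<beta>"
proof -
  note intros = hopf_intros bilin_first[OF \<beta>] bilin_second[OF \<beta>]
  have Z: "sR (\<lambda>r t. sR (\<lambda>r' t'. \<gamma> (antipode r' * antipode r) (antipode t' * t))) = \<gamma> 1 1"
    if \<gamma>: "bilin \<gamma>" for \<gamma>
  proof -
    note intros = hopf_intros bilin_first[OF \<gamma>] bilin_second[OF \<gamma>]
    have "sR (\<lambda>r t. sR (\<lambda>r' t'. \<gamma> (antipode (r * r')) (antipode t' * t)))
        = sR (\<lambda>r t. sw t (\<lambda>a b. \<gamma> (antipode r) (antipode a * b)))"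
      by (rule R_comult_second[symmetric]; intro intros)
    also have "\<dots> = sR (\<lambda>r t. scale (counit t) (\<gamma> (antipode r) 1))"
      using sw_antipode_left[where f = "\<lambda>z. \<gamma> r z" for r] by (simp add: intros)
    also have "\<dots> = \<gamma> (antipode (sR (\<lambda>r t. scale (counit t) r))) 1"
      by (simp add: intros
          lin_tsumD[where f = "\<lambda>z. \<gamma> (antipode z) r" for r]
          lin_scaleD[where f = "\<lambda>z. \<gamma> (antipode z) r" for r])
    finally show ?thesis by (simp add: R_counit_second antipode_one antipode_mult)
  qed
  have "sR (\<lambda>r t. \<beta> (antipode r) (antipode t))
      = sR (\<lambda>r' t'. sR (\<lambda>r t. sR (\<lambda>p q. \<beta> (antipode r' * (antipode r * p)) (antipode t' * (t * q)))))"
    by (subst R_antipode_left_inverse[where \<beta> = "\<lambda>x y. \<beta> (r * x) (t * y)" for r t];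
        (intro intros | simp))
  also have "\<dots> = sR (\<lambda>p q. sR (\<lambda>r t. sR (\<lambda>r' t'. \<beta> (antipode r' * antipode r * p) (antipode t' * t * q))))"
    by (subst (2) tsum_swap, subst tsum_swap, subst (2) tsum_swap) (simp add: mult.assoc)
  also have "\<dots> = sR \<beta>"
    using Z[of "\<lambda>x y. \<beta> (x * p) (y * q)" for p q] by (simp add: intros)
  finally show ?thesis .
qed

abbreviation tw :: "'h \<Rightarrow> ('h \<Rightarrow> 'h \<Rightarrow> 'h) \<Rightarrow> 'h" where
  "tw h \<beta> \<equiv> tsum (transmuted_comult comult antipode R h) \<beta>"

lemma tw_sw: "tw h \<beta> = sw h (\<lambda>a b. sR (\<lambda>r t. \<beta> (a * antipode t) (ad r b)))"
proof -
  have "tsum [(h1 * antipode R2, ad R1 h2). (h1, h2) \<leftarrow> s, (R1, R2) \<leftarrow> u] \<beta>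
      = tsum s (\<lambda>a b. tsum u (\<lambda>r t. \<beta> (a * antipode t) (ad r b)))" for s u
    by (induction s) (auto simp: tsum_def o_def case_prod_unfold)
  then show ?thesis by (simp add: transmuted_comult_def)
qed

text \<open>
  A second formula for the transmuted coproduct, \<Delta>_R(h) = R2 \<cdot> h2 \<otimes> R1 h1. It exhibits the first leg as a
  result of the adjoint action, so that a left coideal stable under this action is also a right coideal
  for \<Delta>_R. The quasi-cocommutativity of R is what makes the legs change places.
\<close>

lemma tw_braided:
  assumes \<beta>: "bilin \<beta>"
  shows "tw h \<beta> = sR (\<lambda>r t. sw h (\<lambda>a b. \<beta> (ad t b) (r * a)))"
proof -
  note intros = ad_intros bilin_first[OF \<beta>] bilin_second[OF \<beta>]
  have "tw h \<beta> = sw h (\<lambda>a b. sR (\<lambda>r t. sw r (\<lambda>c d. \<beta> (a * antipode t) (c * b * antipode d))))"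
    unfolding tw_sw unfolding ad_sw
    by (subst lin_tsumD[where f = "\<lambda>z. \<beta> r z" for r]; (intro intros | simp))
  also have "\<dots> = sw h (\<lambda>a b. sR (\<lambda>r t. sR (\<lambda>r' t'.
      \<beta> (a * antipode (t * t')) (r * b * antipode r'))))"
    by (subst R_comult_first; (intro intros | simp))
  \<comment> \<open>Both antipodes on the legs of the second copy of R disappear together.\<close>
  also have "\<dots> = sw h (\<lambda>a b. sR (\<lambda>r t. sR (\<lambda>r' t'.
      \<beta> (a * t' * antipode t) (r * b * r'))))"
    using R_antipode_antipode[where \<beta> = "\<lambda>r' t'. \<beta> (a * t' * antipode t) (r * b * r')" for a b t r]
    by (simp add: intros antipode_mult mult.assoc)
  also have "\<dots> = sR (\<lambda>r t. sR (\<lambda>r' t'. sw h (\<lambda>a b. \<beta> (a * t' * antipode t) (r * (b * r')))))"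
    by (subst tsum_swap, subst (2) tsum_swap) (simp add: mult.assoc)
  also have "\<dots> = sR (\<lambda>r t. sR (\<lambda>r' t'. sw h (\<lambda>a b. \<beta> (t' * b * antipode t) (r * (r' * a)))))"
    by (subst R_flip[where \<beta> = "\<lambda>x y. \<beta> (y * antipode t) (r * x)" for r t, symmetric];
        (intro intros | simp))
  also have "\<dots> = sR (\<lambda>r t. sw t (\<lambda>c d. sw h (\<lambda>a b. \<beta> (c * b * antipode d) (r * a))))"
    by (subst R_comult_second; (intro intros | simp add: mult.assoc))
  also have "\<dots> = sR (\<lambda>r t. sw h (\<lambda>a b. sw t (\<lambda>c d. \<beta> (c * b * antipode d) (r * a))))"
    by (subst tsum_swap[of "comult h"]) simp
  also have "\<dots> = sR (\<lambda>r t. sw h (\<lambda>a b. \<beta> (ad t b) (r * a)))"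
    by (simp add: ad_sw intros lin_tsumD[where f = "\<lambda>z. \<beta> z r" for r])
  finally show ?thesis .
qed

lemma tw_counit_right: "tw h (\<lambda>a b. scale (counit b) a) = h"
proof -
  have "tw h (\<lambda>a b. scale (counit b) a) = sw h (\<lambda>a b. scale (counit b) (sR (\<lambda>r t. scale (counit r) (a * antipode t))))"
    unfolding tw_sw by (simp add: counit_ad scale_tsum mult.commute)
  also have "\<dots> = sR (\<lambda>r t. scale (counit r) (h * antipode t))"
    by (rule sw_counit_right) (intro hopf_intros)
  also have "\<dots> = h * antipode (sR (\<lambda>r t. scale (counit r) t))"
    by (simp add: hopf_intros lin_tsumD[where f = "\<lambda>z. h * antipode z"]
        lin_scaleD[where f = "\<lambda>z. h * antipode z"])
  finally show ?thesis by (simp add: R_counit_first antipode_one)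
qed

text \<open>
  The coproduct \<Delta> is recovered from \<Delta>_R by means of the inverse (S \<otimes> id)(R) of R.
\<close>

lemma sw_from_tw:
  assumes f: "linear_form scale f"
  shows "sw h (\<lambda>a b. scale (f a) b)
    = sR (\<lambda>r' t'. ad (antipode r') (tw h (\<lambda>a b. scale (f (a * antipode t')) b)))"
proof -
  note intros = ad_intros form_comp[OF f]
  have "sR (\<lambda>r' t'. ad (antipode r') (tw h (\<lambda>a b. scale (f (a * antipode t')) b)))
    = sR (\<lambda>r' t'. sw h (\<lambda>a b. sR (\<lambda>r t. scale (f (a * antipode (t' * t))) (ad (antipode r' * r) b))))"
    unfolding tw_sw
    by (simp add: intros ad_mult antipode_mult mult.assoc
        lin_tsumD[where f = "ad g" for g] lin_scaleD[where f = "ad g" for g])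
  also have "\<dots> = sw h (\<lambda>a b. sR (\<lambda>r' t'. sR (\<lambda>r t. scale (f (a * antipode (t' * t))) (ad (antipode r' * r) b))))"
    by (rule tsum_swap)
  also have "\<dots> = sw h (\<lambda>a b. scale (f a) b)"
    by (subst R_antipode_left_inverse[where \<beta> = "\<lambda>x y. scale (f (a * antipode y)) (ad x b)" for a b];
      (intro intros | simp add: antipode_one ad_one))
  finally show ?thesis by simp
qed

end


section \<open>Invariant subspaces and their complements\<close>

context scalar_space
begin

lemma finite_dimensional_basis:
  assumes "finite_dimensional scale"
  obtains B where "finite B" "independent B" "span B = UNIV"
proof -
  obtain S where S: "finite S" "span S = UNIV"
    using assms by (auto simp: finite_dimensional_def)
  obtain B where B: "independent B" "span B = UNIV"
    using maximal_independent_subset_extend[OF subset_UNIV independent_empty]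
    by (metis top.extremum_unique)
  have "finite B" using independent_span_bound[of S B] S B(1) by simp
  with B that show thesis by blast
qed

text \<open>
  Left ideals, subcoalgebras and Yetter-Drinfeld submodules are all of this kind, for suitable families
  of linear operators.
\<close>

definition invariant_subspace :: "('h \<Rightarrow> 'h) set \<Rightarrow> 'h set \<Rightarrow> bool" where
  "invariant_subspace F W \<longleftrightarrow> subspace W \<and> (\<forall>T\<in>F. \<forall>x\<in>W. T x \<in> W)"

lemma invariant_subspace_Int:
  "invariant_subspace F U \<Longrightarrow> invariant_subspace F W \<Longrightarrow> invariant_subspace F (U \<inter> W)"
  by (auto simp: invariant_subspace_def subspace_inter)

lemma invariant_subspace_span_Union:
  assumes F: "\<And>T. T \<in> F \<Longrightarrow> Vector_Spaces.linear scale scale T"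
    and inv: "\<And>W. W \<in> \<D> \<Longrightarrow> invariant_subspace F W"
  shows "invariant_subspace F (span (\<Union>\<D>))"
  unfolding invariant_subspace_def
proof (intro conjI ballI subspace_span)
  fix T x assume T: "T \<in> F" and "x \<in> span (\<Union>\<D>)"
  interpret T: Vector_Spaces.linear scale scale T by (rule F[OF T])
  show "T x \<in> span (\<Union>\<D>)"
    using \<open>x \<in> span (\<Union>\<D>)\<close>
  proof (induction rule: span_induct_alt)
    case (step c x y)
    then obtain W where W: "W \<in> \<D>" "x \<in> W" by blast
    then have "T x \<in> W"
      using inv T by (auto simp: invariant_subspace_def)
    then have "T x \<in> span (\<Union>\<D>)"
      using W(1) by (intro span_base) blast
    then show ?case
      using step by (simp add: T.add T.scale span_add span_scale)
  qed (simp add: T.zero span_zero)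
qed

definition complementary :: "'h set \<Rightarrow> 'h set \<Rightarrow> bool" where
  "complementary U W \<longleftrightarrow> subspace U \<and> subspace W \<and> U \<inter> W = {0} \<and> (\<forall>x. \<exists>u\<in>U. x - u \<in> W)"

lemma complementary_projection:
  assumes "complementary U W"
  obtains \<pi> where "Vector_Spaces.linear scale scale \<pi>" "\<And>x. \<pi> x \<in> U" "\<And>x. x - \<pi> x \<in> W"
    "\<And>x. x \<in> U \<Longrightarrow> \<pi> x = x" "\<And>x. x \<in> W \<Longrightarrow> \<pi> x = 0"
proof -
  have U: "subspace U" and W: "subspace W" and UW: "U \<inter> W = {0}"
    and ex: "\<exists>u. u \<in> U \<and> x - u \<in> W" for x
    using assms by (auto simp: complementary_def)
  obtain \<pi> where \<pi>: "\<And>x. \<pi> x \<in> U" "\<And>x. x - \<pi> x \<in> W"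
    using ex by metis
  have uniq: "\<pi> x = u" if "u \<in> U" "x - u \<in> W" for x u
  proof -
    have "\<pi> x - u \<in> U" by (rule subspace_diff[OF U \<pi>(1) that(1)])
    moreover have "\<pi> x - u = (x - u) - (x - \<pi> x)" by simp
    then have "\<pi> x - u \<in> W" using subspace_diff[OF W that(2) \<pi>(2)[of x]] by simp
    ultimately have "\<pi> x - u \<in> {0}" using UW by blast
    then show ?thesis by simp
  qed
  have "Vector_Spaces.linear scale scale \<pi>"
  proof (intro Vector_Spaces.linear.intro vector_space_axioms module_hom.intro
      module_hom_axioms.intro module_axioms)
    show "\<pi> (x + y) = \<pi> x + \<pi> y" for x y
      by (rule uniq) (auto intro!: subspace_add[OF U] \<pi> subspace_add[OF W \<pi>(2) \<pi>(2), of x y, THEN back_subst[of "\<lambda>z. z \<in> W"]])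
    show "\<pi> (scale c x) = scale c (\<pi> x)" for c x
      by (rule uniq) (auto intro!: subspace_scale[OF U] \<pi> subspace_scale[OF W \<pi>(2), of c x, THEN back_subst[of "\<lambda>z. z \<in> W"]]
          simp: scale_right_diff_distrib)
  qed
  moreover have "\<pi> x = x" if "x \<in> U" for x
    by (rule uniq) (auto simp: that subspace_0[OF W])
  moreover have "\<pi> x = 0" if "x \<in> W" for x
    by (rule uniq) (auto simp: that subspace_0[OF U])
  ultimately show thesis using that \<pi> by blast
qed

text \<open>
  In a space generated by simple invariant subspaces, an invariant subspace M of maximal dimension with
  N \<inter> M = {0} is a complement of N: a simple subspace not contained in N + M would meet N + M trivially
  and could be added to M.
\<close>

lemma complement_of_invariant_subspace:
  assumes fd: "finite_dimensional scale"
    and F: "\<And>T. T \<in> F \<Longrightarrow> Vector_Spaces.linear scale scale T"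
    and gen: "span (\<Union>\<D>) = UNIV"
    and simple: "\<And>L. L \<in> \<D> \<Longrightarrow> minimal_nonzero (invariant_subspace F) L"
    and N: "invariant_subspace F N"
  obtains M where "invariant_subspace F M" "complementary N M"
proof -
  obtain B where B: "finite B" "independent B" "span B = UNIV"
    by (rule finite_dimensional_basis[OF fd])
  interpret fd: finite_dimensional_vector_space scale B
    by unfold_locales (use B in auto)
  let ?Q = "\<lambda>M. invariant_subspace F M \<and> N \<inter> M = {0}"
  have sN: "subspace N" using N by (simp add: invariant_subspace_def)
  have "?Q {0}"
    using subspace_0[OF sN] F
    by (auto simp: invariant_subspace_def lin_zeroD)
  then obtain M where M: "?Q M" and max: "\<And>M'. ?Q M' \<Longrightarrow> dim M' \<le> dim M"
    using ex_has_greatest_nat[of ?Q "{0}" dim "Suc fd.dimension"] fd.dim_subset_UNIV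
    by (auto simp: less_Suc_eq_le)
  have sM: "subspace M" using M by (simp add: invariant_subspace_def)
  define K where "K = span (\<Union>{N, M})"
  have K: "invariant_subspace F K"
    unfolding K_def by (rule invariant_subspace_span_Union[OF F]) (use N M in auto)
  have K_sum: "\<exists>n\<in>N. x - n \<in> M" if x: "x \<in> K" for x
  proof -
    obtain n m where "x = n + m" "n \<in> span N" "m \<in> span M"
      using x span_Un[of N M] by (auto simp: K_def)
    then have "n \<in> N" "m \<in> M" "x - n = m"
      using sN sM by (simp_all add: span_eq_iff[THEN iffD2])
    then show ?thesis by (intro bexI[of _ n]) simp_all
  qed
  have "L \<subseteq> K" if L: "L \<in> \<D>" for L
  proof (rule ccontr)
    assume "\<not> L \<subseteq> K"
    have Linv: "invariant_subspace F L" and L0: "L \<noteq> {0}"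
      using simple[OF L] by (auto simp: minimal_nonzero_def)
    have LK: "L \<inter> K = {0}"
      using simple[OF L] invariant_subspace_Int[OF Linv K] \<open>\<not> L \<subseteq> K\<close>
      unfolding minimal_nonzero_def by blast
    define M' where "M' = span (\<Union>{M, L})"
    have "invariant_subspace F M'"
      unfolding M'_def by (rule invariant_subspace_span_Union[OF F]) (use Linv M in auto)
    moreover have "N \<inter> M' = {0}"
    proof (intro equalityI subsetI)
      fix x assume x: "x \<in> N \<inter> M'"
      then obtain m l where ml: "x = m + l" "m \<in> span M" "l \<in> span L"
        using span_Un[of M L] by (auto simp: M'_def)
      then have ml': "m \<in> M" "l \<in> L"
        using sM Linv by (simp_all add: span_eq_iff[THEN iffD2] invariant_subspace_def)
      have "x \<in> K" "m \<in> K"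
        using x ml' by (auto simp: K_def intro: span_base)
      then have "x - m \<in> K" using K subspace_diff by (auto simp: invariant_subspace_def)
      then have "l = 0" using LK ml' ml(1) by auto
      then show "x \<in> {0}" using x ml(1) ml'(1) M by auto
    qed (use sN in \<open>auto simp: M'_def subspace_0 span_zero\<close>)
    ultimately have "dim M' \<le> dim M" using max by blast
    moreover have "M \<subseteq> M'" "L \<subseteq> M'" by (auto simp: M'_def intro: span_base)
    moreover have "\<not> L \<subseteq> M" using \<open>\<not> L \<subseteq> K\<close> by (auto simp: K_def intro: span_base)
    ultimately have "M \<subset> M'" by blast
    then have "dim M < dim M'"
      using sM by (intro fd.dim_psubset) (simp add: M'_def span_eq_iff[THEN iffD2])
    with \<open>dim M' \<le> dim M\<close> show False by simp
  qed
  then have "span (\<Union>\<D>) \<subseteq> K"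
    using K by (intro span_minimal) (auto simp: invariant_subspace_def)
  then have "complementary N M"
    using gen K_sum sN sM M by (auto simp: complementary_def)
  with M that show thesis by blast
qed

end

context coalgebra
begin

lemma subcoalgebra_iff_invariant:
  assumes "finite_dimensional scale"
  shows "subcoalgebra scale comult D \<longleftrightarrow> invariant_subspace
    ({\<lambda>h. sw h (\<lambda>a b. scale (f a) b) | f. linear_form scale f} \<union>
     {\<lambda>h. sw h (\<lambda>a b. scale (f b) a) | f. linear_form scale f}) D"
  unfolding subcoalgebra_def invariant_subspace_def
  using in_tensor_self_iff[OF assms, of D] by fastforce

text \<open>
  For a group-like element u the line spanned by u is a subcoalgebra, so it has a complementary
  subcoalgebra C by cosemisimplicity. The projection onto the line along C is the required form: both
  Sweedler sums can be computed separately on the line and on C, where the form vanishes.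
\<close>

lemma normalized_cointegral:
  assumes fd: "finite_dimensional scale" and cos: "cosemisimple_coalgebra scale comult"
    and counit1: "counit u = 1"
    and group_like: "\<And>\<beta>. bilin \<beta> \<Longrightarrow> sw u \<beta> = \<beta> u u"
  obtains \<mu> where "linear_form scale \<mu>" "\<mu> u = 1"
    "\<And>h. sw h (\<lambda>a b. scale (\<mu> a) b) = scale (\<mu> h) u"
    "\<And>h. sw h (\<lambda>a b. scale (\<mu> b) a) = scale (\<mu> h) u"
proof -
  let ?F = "{\<lambda>h. sw h (\<lambda>a b. scale (f a) b) | f. linear_form scale f} \<union>
     {\<lambda>h. sw h (\<lambda>a b. scale (f b) a) | f. linear_form scale f}"
  obtain \<C> where \<C>: "direct_sum_decomposition scale \<C>"
    "\<And>C. C \<in> \<C> \<Longrightarrow> minimal_nonzero (subcoalgebra scale comult) C"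
    using cos by (auto simp: cosemisimple_coalgebra_def)
  have eq: "subcoalgebra scale comult = invariant_subspace ?F"
    using subcoalgebra_iff_invariant[OF fd] by (intro ext)
  obtain C where C: "invariant_subspace ?F C" "complementary (span {u}) C"
  proof (rule complement_of_invariant_subspace[OF fd])
    show "span (\<Union>\<C>) = UNIV" using \<C>(1) by (simp add: direct_sum_decomposition_def)
    show "minimal_nonzero (invariant_subspace ?F) L" if "L \<in> \<C>" for L
      using \<C>(2)[OF that] unfolding eq .
    show "invariant_subspace ?F (span {u})" proof -
      have *: "T (scale c u) \<in> span {u}" if "T \<in> ?F" for T c
        using that lin_scaleD[OF lin_sw[OF lin_id]]
        by (auto simp: group_like lin_intros bilinI span_singleton)
      then show ?thesis
        unfolding invariant_subspace_def
      proof (intro conjI subspace_span ballI)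
        fix T x assume "T \<in> ?F" "x \<in> span {u}"
        moreover from this(2) obtain c where "x = scale c u" by (auto simp: span_singleton)
        ultimately show "T x \<in> span {u}"
          using * by simp
      qed
    qed
    show "lin T" if "T \<in> ?F" for T
      using that by (auto intro!: lin_sw lin_intros lin_intros)
  qed
  obtain \<pi> where \<pi>: "lin \<pi>" "\<And>x. \<pi> x \<in> span {u}" "\<And>x. x - \<pi> x \<in> C"
    "\<And>x. x \<in> span {u} \<Longrightarrow> \<pi> x = x" "\<And>x. x \<in> C \<Longrightarrow> \<pi> x = 0"
    by (rule complementary_projection[OF C(2)]) blast
  define \<mu> where "\<mu> x = counit (\<pi> x)" for x
  have lam: "linear_form scale \<mu>"
    unfolding \<mu>_def by (intro form_counit \<pi>(1))
  have \<mu>_u: "\<mu> u = 1"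
    by (simp add: \<mu>_def \<pi>(4) span_base counit1)
  have \<pi>_eq: "\<pi> x = scale (\<mu> x) u" for x
  proof -
    obtain c where "\<pi> x = scale c u"
      using \<pi>(2)[of x] by (auto simp: span_singleton)
    then show ?thesis by (simp add: \<mu>_def form_scaleD[OF counit_linear] counit1)
  qed
  have C0: "\<mu> x = 0" if "x \<in> C" for x
    by (simp add: \<mu>_def \<pi>(5)[OF that] form_zeroD[OF counit_linear])
  have conv: "sw c \<beta> = 0" if c: "c \<in> C" and \<beta>: "bilin \<beta>" and 0: "\<And>a b. a \<in> C \<Longrightarrow> b \<in> C \<Longrightarrow> \<beta> a b = 0" for c \<beta>
  proof -
    have "in_tensor scale scale C C (comult c)"
      using C(1) c by (auto simp: eq[symmetric] subcoalgebra_def)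
    then obtain s where s: "set s \<subseteq> C \<times> C" "tensor_eq scale scale (comult c) s"
      by (auto simp: in_tensor_def)
    have "tsum s \<beta> = tsum s (\<lambda>a b. 0)"
      using s(1) 0 by (intro tsum_cong) auto
    then show ?thesis using tsum_eq_bilin[OF s(2) \<beta>] by simp
  qed
  have main: "sw h \<beta> = scale (\<mu> h) (\<beta> u u)"
    if \<beta>: "bilin \<beta>" and 0: "\<And>a b. a \<in> C \<Longrightarrow> b \<in> C \<Longrightarrow> \<beta> a b = 0" for h \<beta>
  proof -
    have l: "lin (\<lambda>h. sw h \<beta>)" by (intro lin_sw lin_id \<beta>)
    have "sw h \<beta> = sw (scale (\<mu> h) u + (h - \<pi> h)) \<beta>" by (simp add: \<pi>_eq)
    also have "\<dots> = scale (\<mu> h) (sw u \<beta>) + sw (h - \<pi> h) \<beta>"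
      by (simp only: lin_addD[OF l] lin_scaleD[OF l])
    also have "\<dots> = scale (\<mu> h) (\<beta> u u)"
      by (simp add: conv[OF \<pi>(3) \<beta> 0] group_like[OF \<beta>])
    finally show ?thesis .
  qed
  show thesis
  proof
    show "sw h (\<lambda>a b. scale (\<mu> a) b) = scale (\<mu> h) u" for h
      using main[of "\<lambda>a b. scale (\<mu> a) b" h] lam C0 by (simp add: lin_intros \<mu>_u)
    show "sw h (\<lambda>a b. scale (\<mu> b) a) = scale (\<mu> h) u" for h
      using main[of "\<lambda>a b. scale (\<mu> b) a" h] lam C0 by (simp add: lin_intros \<mu>_u)
  qed fact+
qed

end


section \<open>Integrals\<close>

context hopf_algebra
begin

lemma left_ideal_iff_invariant: "left_ideal scale L \<longleftrightarrow> invariant_subspace (range (*)) L"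
  by (auto simp: left_ideal_def invariant_subspace_def)

text \<open>
  The component of 1 in N, for a decomposition of H into N and a complementary left ideal.
\<close>

lemma left_ideal_right_unit:
  assumes fd: "finite_dimensional scale" and ss: "semisimple_algebra scale"
    and N: "left_ideal scale N"
  obtains e where "e \<in> N" "\<And>x. x \<in> N \<Longrightarrow> x * e = x"
proof -
  have eq: "left_ideal scale = invariant_subspace (range (*))"
    using left_ideal_iff_invariant by (intro ext)
  obtain \<L> where \<L>: "direct_sum_decomposition scale \<L>"
    "\<And>L. L \<in> \<L> \<Longrightarrow> minimal_nonzero (left_ideal scale) L"
    using ss by (auto simp: semisimple_algebra_def)
  obtain M where M: "invariant_subspace (range (*)) M" "complementary N M"
  proof (rule complement_of_invariant_subspace[OF fd])
    show "span (\<Union>\<L>) = UNIV" using \<L>(1) by (simp add: direct_sum_decomposition_def)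
    show "minimal_nonzero (invariant_subspace (range (*))) L" if "L \<in> \<L>" for L
      using \<L>(2)[OF that] unfolding eq .
    show "invariant_subspace (range (*)) N" using N unfolding eq .
    show "lin T" if "T \<in> range (*)" for T
      using that by (auto intro: hopf_intros)
  qed
  then obtain e where e: "e \<in> N" "1 - e \<in> M" by (auto simp: complementary_def)
  have "x * e = x" if x: "x \<in> N" for x
  proof -
    have "x - x * e \<in> N"
      using N x e(1) subspace_diff by (auto simp: left_ideal_def)
    moreover have "x * (1 - e) \<in> M"
      using M(1) e(2) by (auto simp: invariant_subspace_def)
    then have "x - x * e \<in> M" by (simp add: right_diff_distrib)
    ultimately have "x - x * e \<in> {0}" using M(2) unfolding complementary_def by blast
    then show ?thesis by simp
  qed
  with e(1) that show thesis by blast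
qed

text \<open>
  The augmentation ideal N has a right unit e, and \<Lambda> = 1 - e is a left integral. It is also a right
  integral: the left ideal \<Lambda> N squares to zero because N \<Lambda> = 0, and a nilpotent left ideal with a right unit
  vanishes.
\<close>

lemma normalized_integral:
  assumes fd: "finite_dimensional scale" and ss: "semisimple_algebra scale"
  obtains \<Lambda> where "counit \<Lambda> = 1" "\<And>h. h * \<Lambda> = scale (counit h) \<Lambda>" "\<And>h. \<Lambda> * h = scale (counit h) \<Lambda>"
proof -
  note counit = form_addD[OF counit_linear] form_scaleD[OF counit_linear] form_zeroD[OF counit_linear]
  have counit_diff: "counit (x - y) = counit x - counit y" for x y
    using counit(1)[of "x - y" y] by simp
  let ?N = "{h. counit h = 0}"
  have N: "left_ideal scale ?N"
    by (auto simp: left_ideal_def subspace_def counit counit_mult)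
  obtain e where e: "e \<in> ?N" "\<And>x. x \<in> ?N \<Longrightarrow> x * e = x"
    by (rule left_ideal_right_unit[OF fd ss N]) blast
  define \<Lambda> where "\<Lambda> = 1 - e"
  have \<Lambda>1: "counit \<Lambda> = 1" using e(1) by (simp add: \<Lambda>_def counit_diff counit_one)
  have ker: "x * \<Lambda> = 0" if "counit x = 0" for x
    using e(2)[of x] that by (simp add: \<Lambda>_def right_diff_distrib)
  have left: "h * \<Lambda> = scale (counit h) \<Lambda>" for h
    using ker[of "h - scale (counit h) 1"]
    by (simp add: counit_diff counit counit_one left_diff_distrib scale_mult_left)
  have I: "left_ideal scale ((*) \<Lambda> ` ?N)"
    unfolding left_ideal_def
  proof (intro conjI allI ballI)
    show "subspace ((*) \<Lambda> ` ?N)"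
      using N by (intro module_hom.subspace_image[of scale scale]) 
        (auto simp: left_ideal_def Vector_Spaces.linear_iff_module_hom[symmetric] intro: hopf_intros)
    show "h * x \<in> (*) \<Lambda> ` ?N" if x: "x \<in> (*) \<Lambda> ` ?N" for h x
    proof -
      obtain y where y: "x = \<Lambda> * y" "counit y = 0" using x by auto
      have "h * x = \<Lambda> * scale (counit h) y"
        by (simp add: y(1) mult.assoc[symmetric] left scale_mult_left scale_mult_right)
      then show ?thesis using y(2) by (auto simp: counit)
    qed
  qed
  obtain e' where e': "e' \<in> (*) \<Lambda> ` ?N" "\<And>x. x \<in> (*) \<Lambda> ` ?N \<Longrightarrow> x * e' = x"
    by (rule left_ideal_right_unit[OF fd ss I]) blast
  have ker': "\<Lambda> * x = 0" if x: "counit x = 0" for x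
  proof -
    obtain y where "e' = \<Lambda> * y" using e'(1) by auto
    then have "\<Lambda> * x = \<Lambda> * (x * \<Lambda>) * y"
      using e'(2)[of "\<Lambda> * x"] x by (simp add: mult.assoc)
    then show ?thesis using ker[OF x] by simp
  qed
  have right: "\<Lambda> * h = scale (counit h) \<Lambda>" for h
    using ker'[of "h - scale (counit h) 1"]
    by (simp add: counit_diff counit counit_one right_diff_distrib scale_mult_right)
  show thesis using that \<Lambda>1 left right by blast
qed

end

text \<open>
  The consequences of semisimplicity and cosemisimplicity that enter the averaging arguments: normalized
  two-sided integrals \<Lambda> in H and \<mu> in the dual of H.
\<close>

locale hopf_algebra_with_integrals = hopf_algebra scale comult counit antipode
  for scale :: "'k::field \<Rightarrow> 'h::ring_1 \<Rightarrow> 'h" and comult counit antipode +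
  fixes \<Lambda> :: 'h and \<mu> :: "'h \<Rightarrow> 'k"
  assumes finite_dim: "finite_dimensional scale"
    and counit_integral: "counit \<Lambda> = 1"
    and integral_left: "h * \<Lambda> = scale (counit h) \<Lambda>"
    and integral_right: "\<Lambda> * h = scale (counit h) \<Lambda>"
    and cointegral_linear: "linear_form scale \<mu>"
    and cointegral_one: "\<mu> 1 = 1"
    and cointegral_first: "sw h (\<lambda>a b. scale (\<mu> a) b) = scale (\<mu> h) 1"
    and cointegral_second: "sw h (\<lambda>a b. scale (\<mu> b) a) = scale (\<mu> h) 1"
begin

lemmas int_intros = ad_intros form_comp[OF cointegral_linear]

text \<open>
  Insert S(a1) a2 into the first leg and absorb \<Delta>(a2) into \<Delta>(\<Lambda>). The next two lemmas move factors past \<Lambda>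
  in the same way.
\<close>

lemma integral_move_left:
  assumes \<beta>: "bilin \<beta>"
  shows "sw \<Lambda> (\<lambda>x y. \<beta> (antipode a * x) y) = sw \<Lambda> (\<lambda>x y. \<beta> x (a * y))"
proof -
  note intros = int_intros bilin_first[OF \<beta>] bilin_second[OF \<beta>]
  have "sw \<Lambda> (\<lambda>x y. \<beta> (antipode a * x) y)
      = sw a (\<lambda>a1 m. scale (counit m) (sw \<Lambda> (\<lambda>x y. \<beta> (antipode a1 * x) y)))"
    by (rule sw_counit_right[symmetric]) (intro intros)
  also have "\<dots> = sw a (\<lambda>a1 m. sw (m * \<Lambda>) (\<lambda>x y. \<beta> (antipode a1 * x) y))"
    by (simp add: integral_left lin_scaleD[OF lin_sw[OF lin_id]] intros)
  also have "\<dots> = sw a (\<lambda>a1 m. sw m (\<lambda>a2 a3. sw \<Lambda> (\<lambda>x y. \<beta> (antipode a1 * (a2 * x)) (a3 * y))))"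
    by (simp add: sw_mult intros)
  also have "\<dots> = sw a (\<lambda>m a3. sw m (\<lambda>a1 a2. sw \<Lambda> (\<lambda>x y. \<beta> (antipode a1 * a2 * x) (a3 * y))))"
    by (subst sw_coassoc; (intro intros | simp add: mult.assoc))
  also have "\<dots> = sw a (\<lambda>m a3. scale (counit m) (sw \<Lambda> (\<lambda>x y. \<beta> x (a3 * y))))"
    using sw_antipode_left[where f = "\<lambda>z. sw \<Lambda> (\<lambda>x y. \<beta> (z * x) (a3 * y))" for a3]
    by (simp add: intros)
  also have "\<dots> = sw \<Lambda> (\<lambda>x y. \<beta> x (a * y))"
    by (rule sw_counit_left) (intro intros)
  finally show ?thesis .
qed

lemma integral_move_right:
  assumes \<beta>: "bilin \<beta>"
  shows "sw \<Lambda> (\<lambda>x y. \<beta> (x * a) y) = sw \<Lambda> (\<lambda>x y. \<beta> x (y * antipode a))"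
proof -
  note intros = int_intros bilin_first[OF \<beta>] bilin_second[OF \<beta>]
  have "sw \<Lambda> (\<lambda>x y. \<beta> x (y * antipode a))
      = sw a (\<lambda>m a3. scale (counit m) (sw \<Lambda> (\<lambda>x y. \<beta> x (y * antipode a3))))"
    by (rule sw_counit_left[symmetric]) (intro intros)
  also have "\<dots> = sw a (\<lambda>m a3. sw (\<Lambda> * m) (\<lambda>x y. \<beta> x (y * antipode a3)))"
    by (simp add: integral_right lin_scaleD[OF lin_sw[OF lin_id]] intros)
  also have "\<dots> = sw a (\<lambda>m a3. sw m (\<lambda>a1 a2. sw \<Lambda> (\<lambda>x y. \<beta> (x * a1) (y * a2 * antipode a3))))"
    by (subst tsum_swap) (simp add: sw_mult intros)
  also have "\<dots> = sw a (\<lambda>a1 m. sw m (\<lambda>a2 a3. sw \<Lambda> (\<lambda>x y. \<beta> (x * a1) (y * (a2 * antipode a3)))))"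
    by (subst sw_coassoc; (intro intros | simp add: mult.assoc))
  also have "\<dots> = sw a (\<lambda>a1 m. scale (counit m) (sw \<Lambda> (\<lambda>x y. \<beta> (x * a1) y)))"
    using sw_antipode_right[where f = "\<lambda>z. sw \<Lambda> (\<lambda>x y. \<beta> (x * a1) (y * z))" for a1]
    by (simp add: intros)
  also have "\<dots> = sw \<Lambda> (\<lambda>x y. \<beta> (x * a) y)"
    by (rule sw_counit_right) (intro intros)
  finally show ?thesis by simp
qed

text \<open>
  The tensor \<Lambda>1 \<otimes> S(\<Lambda>2) commutes with H; averaging a linear map against it yields an H-linear map.
\<close>

lemma integral_casimir:
  assumes \<beta>: "bilin \<beta>"
  shows "sw \<Lambda> (\<lambda>x y. \<beta> (h * x) (antipode y)) = sw \<Lambda> (\<lambda>x y. \<beta> x (antipode y * h))"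
proof -
  note intros = int_intros bilin_first[OF \<beta>] bilin_second[OF \<beta>]
  have "sw \<Lambda> (\<lambda>x y. \<beta> x (antipode y * h))
      = sw h (\<lambda>m h3. scale (counit m) (sw \<Lambda> (\<lambda>x y. \<beta> x (antipode y * h3))))"
    by (rule sw_counit_left[symmetric]) (intro intros)
  also have "\<dots> = sw h (\<lambda>m h3. sw (m * \<Lambda>) (\<lambda>x y. \<beta> x (antipode y * h3)))"
    by (simp add: integral_left lin_scaleD[OF lin_sw[OF lin_id]] intros)
  also have "\<dots> = sw h (\<lambda>m h3. sw m (\<lambda>h1 h2. sw \<Lambda> (\<lambda>x y. \<beta> (h1 * x) (antipode y * (antipode h2 * h3)))))"
    by (simp add: sw_mult intros antipode_mult mult.assoc)
  also have "\<dots> = sw h (\<lambda>h1 m. sw m (\<lambda>h2 h3. sw \<Lambda> (\<lambda>x y. \<beta> (h1 * x) (antipode y * (antipode h2 * h3)))))"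
    by (rule sw_coassoc; intro intros)
  also have "\<dots> = sw h (\<lambda>h1 m. scale (counit m) (sw \<Lambda> (\<lambda>x y. \<beta> (h1 * x) (antipode y))))"
    using sw_antipode_left[where f = "\<lambda>z. sw \<Lambda> (\<lambda>x y. \<beta> (h1 * x) (antipode y * z))" for h1]
    by (simp add: intros)
  also have "\<dots> = sw \<Lambda> (\<lambda>x y. \<beta> (h * x) (antipode y))"
    by (rule sw_counit_right) (intro intros)
  finally show ?thesis by simp
qed

lemma integral_dual_left: "sw \<Lambda> (\<lambda>x y. scale (\<mu> (antipode a * x)) y) = scale (\<mu> \<Lambda>) a"
proof -
  have "sw \<Lambda> (\<lambda>x y. scale (\<mu> (antipode a * x)) y) = sw \<Lambda> (\<lambda>x y. scale (\<mu> x) (a * y))"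
    by (rule integral_move_left) (intro int_intros)
  also have "\<dots> = a * sw \<Lambda> (\<lambda>x y. scale (\<mu> x) y)"
    by (simp add: tsum_mult_left scale_mult_right)
  finally show ?thesis by (simp add: cointegral_first scale_mult_right)
qed

lemma integral_dual_right: "sw \<Lambda> (\<lambda>x y. scale (\<mu> (x * a)) y) = scale (\<mu> \<Lambda>) (antipode a)"
proof -
  have "sw \<Lambda> (\<lambda>x y. scale (\<mu> (x * a)) y) = sw \<Lambda> (\<lambda>x y. scale (\<mu> x) (y * antipode a))"
    by (rule integral_move_right) (intro int_intros)
  also have "\<dots> = sw \<Lambda> (\<lambda>x y. scale (\<mu> x) y) * antipode a"
    by (simp add: tsum_mult_right scale_mult_left)
  finally show ?thesis by (simp add: cointegral_first scale_mult_left)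
qed

text \<open>
  If \<mu>(\<Lambda>) were zero then \<mu>(\<Lambda>1 a) \<Lambda>2 = \<mu>(\<Lambda>) S(a) would vanish for all a, and so would
  \<mu>(\<Lambda>1 S(\<Lambda>2)) = \<epsilon>(\<Lambda>) \<mu>(1) = 1. Since the argument a may not depend on \<Lambda>2, the vector S(\<Lambda>2) is first
  expanded in terms of a basis.
\<close>

lemma cointegral_integral_nonzero: "\<mu> \<Lambda> \<noteq> 0"
proof
  assume 0: "\<mu> \<Lambda> = 0"
  obtain B where B: "finite B" "independent B" "span B = UNIV"
    by (rule finite_dimensional_basis[OF finite_dim])
  have "antipode y = (\<Sum>e\<in>B. scale (representation B y e) (antipode e))" for y
  proof -
    interpret S: Vector_Spaces.linear scale scale antipode by (rule antipode_linear)
    show ?thesis by (subst (1) basis_expansion[OF B, of y, symmetric]) (simp only: S.sum S.scale)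
  qed
  then have "sw \<Lambda> (\<lambda>x y. scale (\<mu> (x * antipode y)) 1)
      = sw \<Lambda> (\<lambda>x y. \<Sum>e\<in>B. scale (representation B (scale (\<mu> (x * antipode e)) y) e) 1)"
  proof -
    interpret \<mu>: Vector_Spaces.linear scale "(*)" \<mu> by (rule cointegral_linear)
    have "scale (\<mu> (x * antipode y)) 1
      = (\<Sum>e\<in>B. scale (representation B (scale (\<mu> (x * antipode e)) y) e) 1)" for x y
    proof -
      have "\<mu> (x * antipode y) = \<mu> (\<Sum>e\<in>B. scale (representation B y e) (x * antipode e))"
        by (subst \<open>antipode y = _\<close>) (simp add: sum_distrib_left scale_mult_right)
      also have "\<dots> = (\<Sum>e\<in>B. representation B (scale (\<mu> (x * antipode e)) y) e)"
        using B by (simp add: \<mu>.sum \<mu>.scale representation_scale mult.commute)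
      finally show ?thesis by (simp add: scale_sum_left)
    qed
    then show ?thesis by simp
  qed
  also have "\<dots> = (\<Sum>e\<in>B. scale (representation B (sw \<Lambda> (\<lambda>x y. scale (\<mu> (x * antipode e)) y)) e) 1)"
    unfolding tsum_sum
    by (intro sum.cong refl lin_tsumD[symmetric, where f = "\<lambda>z. scale (representation B z e) 1" for e]
        lin_form_scale linear_form_representation B)
  also have "\<dots> = 0"
    using B by (simp add: integral_dual_right 0 representation_zero)
  finally have "sw \<Lambda> (\<lambda>x y. scale (\<mu> (x * antipode y)) 1) = 0" .
  moreover have "sw \<Lambda> (\<lambda>x y. scale (\<mu> (x * antipode y)) 1) = scale (counit \<Lambda>) (scale (\<mu> 1) 1)"
    by (rule sw_antipode_right[where f = "\<lambda>z. scale (\<mu> z) 1"]) (intro int_intros)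
  ultimately show False by (simp add: counit_integral cointegral_one)
qed

text \<open>
  By integral_dual_left the vector \<mu>(\<Lambda>) a is determined by S(a), so S is injective, and H is finite dimensional.
\<close>

lemma antipode_surj: "surj antipode"
proof -
  obtain B where B: "finite B" "independent B" "span B = UNIV"
    by (rule finite_dimensional_basis[OF finite_dim])
  interpret fd: finite_dimensional_vector_space scale B
    by unfold_locales (use B in auto)
  have "inj antipode"
  proof (rule injI)
    fix x y assume "antipode x = antipode y"
    then have "scale (\<mu> \<Lambda>) x = scale (\<mu> \<Lambda>) y"
      by (metis integral_dual_left)
    then show "x = y" by (rule scale_left_imp_eq[OF cointegral_integral_nonzero])
  qed
  then show ?thesis by (rule fd.linear_inj_imp_surj[OF antipode_linear])
qed

text \<open>
  The cointegral is a trace twisted by the square of the antipode. Let g(x) = \<mu>(x a) - \<mu>(S(S(a)) x). The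
  two evaluations of \<Lambda> by \<mu> give g(\<Lambda>1) \<Lambda>2 = 0, and applying \<mu>(b _) turns this into \<mu>(\<Lambda>) g(S(b)) = 0;
  finally S is surjective.
\<close>

lemma cointegral_trace: "\<mu> (y * a) = \<mu> (antipode (antipode a) * y)"
proof -
  define g where "g x = \<mu> (x * a) - \<mu> (antipode (antipode a) * x)" for x
  have g: "linear_form scale g"
    unfolding g_def
    using form_addD[OF cointegral_linear] form_scaleD[OF cointegral_linear]
    by (intro formI) (simp_all add: algebra_simps scale_mult_left scale_mult_right)
  obtain b where b: "y = antipode b" using antipode_surj by (metis surjD)
  have "sw \<Lambda> (\<lambda>x y. scale (g x) y) = 0"
  proof -
    have "g x + \<mu> (antipode (antipode a) * x) = \<mu> (x * a)" for x by (simp add: g_def)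
    moreover
    have "sw \<Lambda> (\<lambda>x y. scale (g x + \<mu> (antipode (antipode a) * x)) y)
        = sw \<Lambda> (\<lambda>x y. scale (g x) y) + sw \<Lambda> (\<lambda>x y. scale (\<mu> (antipode (antipode a) * x)) y)"
      by (simp only: scale_left_distrib tsum_add)
    ultimately show ?thesis by (simp add: integral_dual_left integral_dual_right)
  qed
  then have "scale (\<mu> (b * sw \<Lambda> (\<lambda>x y. scale (g x) y))) 1 = 0"
    using form_zeroD[OF cointegral_linear] by simp
  also have "scale (\<mu> (b * sw \<Lambda> (\<lambda>x y. scale (g x) y))) 1
      = sw \<Lambda> (\<lambda>x y. scale (g x) (scale (\<mu> (b * y)) 1))"
    by (simp add: lin_tsumD[where f = "\<lambda>z. scale (\<mu> (b * z)) 1"] int_intros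
      scale_mult_right form_scaleD[OF cointegral_linear])
  also have "\<dots> = sw \<Lambda> (\<lambda>x y. scale (g (antipode b * x)) (scale (\<mu> y) 1))"
    by (rule integral_move_left[symmetric]) (intro int_intros g)
  also have "\<dots> = scale (g (antipode b * sw \<Lambda> (\<lambda>x y. scale (\<mu> y) x))) 1"
    by (simp add: lin_tsumD[where f = "\<lambda>z. scale (g (antipode b * z)) 1"] int_intros form_comp[OF g]
      scale_mult_right form_scaleD[OF g] mult.commute)
  also have "\<dots> = scale (\<mu> \<Lambda> * g y) 1"
    by (simp only: cointegral_second scale_mult_right form_scaleD[OF g] b mult_1_right)
  finally show ?thesis using cointegral_integral_nonzero by (simp add: g_def)
qed

end


section \<open>Yetter-Drinfeld submodules\<close>

context hopf_algebra
begin

lemma yetter_drinfeld_submodule_iff: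
  assumes fd: "finite_dimensional scale"
  shows "yetter_drinfeld_submodule scale scale ad comult D \<longleftrightarrow>
    subspace D \<and> (\<forall>h. \<forall>d\<in>D. ad h d \<in> D) \<and>
    (\<forall>f. \<forall>d\<in>D. linear_form scale f \<longrightarrow> sw d (\<lambda>a b. scale (f a) b) \<in> D)"
proof -
  obtain B where B: "finite B" "independent B" "span B = UNIV"
    by (rule finite_dimensional_basis[OF fd])
  show ?thesis
    unfolding yetter_drinfeld_submodule_def
    using in_tensor_UNIV_iff[OF vector_space_axioms B, of D] by blast
qed

lemma yetter_drinfeld_module_adjoint:
  assumes fd: "finite_dimensional scale"
  shows "yetter_drinfeld_module scale comult counit antipode scale ad comult"
proof
  fix h v
  obtain B where B: "finite B" "independent B" "span B = UNIV"
    by (rule finite_dimensional_basis[OF fd])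
  let ?t = "[(h1 * a * antipode h3, ad h2 w).
    (h1, h2, h3) \<leftarrow> map_first comult (comult h), (a, w) \<leftarrow> comult v]"
  show "tensor_eq scale scale (comult (ad h v)) ?t"
  proof (rule tensor_eqI[OF vector_space_axioms B])
    fix f assume f: "linear_form scale f"
    have "tsum [(h1 * a * antipode h3, ad h2 w). (h1, h2, h3) \<leftarrow> s, (a, w) \<leftarrow> u] \<beta>
      = (\<Sum>(h1, h2, h3)\<leftarrow>s. tsum u (\<lambda>a w. \<beta> (h1 * a * antipode h3) (ad h2 w)))"
      for s u and \<beta> :: "'h \<Rightarrow> 'h \<Rightarrow> 'h"
      by (induction s) (auto simp: tsum_def o_def case_prod_unfold)
    then have "tsum ?t (\<lambda>a b. scale (f a) b) =
      sw h (\<lambda>x h3. sw x (\<lambda>h1 h2. sw v (\<lambda>a w. scale (f (h1 * a * antipode h3)) (ad h2 w))))"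
      by (simp add: tsum_map_first)
    then show "sw (ad h v) (\<lambda>a b. scale (f a) b) = tsum ?t (\<lambda>a b. scale (f a) b)"
      using f by (simp add: comult_ad hopf_intros)
  qed
qed (auto simp: ad_one ad_mult comult_linear coassoc counit_left
    lin_addD[OF lin_ad_first[OF lin_id]] lin_scaleD[OF lin_ad_first[OF lin_id]]
    lin_addD[OF lin_ad_second[OF lin_id]] lin_scaleD[OF lin_ad_second[OF lin_id]])

end

context quasitriangular_hopf_algebra
begin

text \<open>
  Every Yetter-Drinfeld submodule is a subcoalgebra of the transmuted coalgebra: the definition of \<Delta>_R
  controls its second leg and the formula tw_braided its first leg. The converse uses that \<Delta> can be
  recovered from \<Delta>_R.
\<close>

theorem adjoint_stable_subcoalgebra_iff_yetter_drinfeld_submodule: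
  assumes fd: "finite_dimensional scale"
  shows "adjoint_stable_subcoalgebra scale comult antipode R D
    \<longleftrightarrow> yetter_drinfeld_submodule scale scale ad comult D"
proof
  assume "adjoint_stable_subcoalgebra scale comult antipode R D"
  then have D: "subspace D" "\<And>h d. d \<in> D \<Longrightarrow> ad h d \<in> D"
    and tw: "\<And>f d. d \<in> D \<Longrightarrow> linear_form scale f \<Longrightarrow> tw d (\<lambda>a b. scale (f a) b) \<in> D"
    using in_tensor_self_iff[OF fd, of D]
    by (auto simp: adjoint_stable_subcoalgebra_def subcoalgebra_def)
  have "sw d (\<lambda>a b. scale (f a) b) \<in> D" if "d \<in> D" "linear_form scale f" for d f
    unfolding sw_from_tw[OF that(2)]
    by (intro tsum_in_subspace D tw that form_comp[OF that(2)] hopf_intros)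
  with D show "yetter_drinfeld_submodule scale scale ad comult D"
    by (simp add: yetter_drinfeld_submodule_iff[OF fd])
next
  assume "yetter_drinfeld_submodule scale scale ad comult D"
  then have D: "subspace D" "\<And>h d. d \<in> D \<Longrightarrow> ad h d \<in> D"
    and coideal: "\<And>f d. d \<in> D \<Longrightarrow> linear_form scale f \<Longrightarrow> sw d (\<lambda>a b. scale (f a) b) \<in> D"
    by (auto simp: yetter_drinfeld_submodule_iff[OF fd])
  have "tw d (\<lambda>a b. scale (f a) b) \<in> D \<and> tw d (\<lambda>a b. scale (f b) a) \<in> D"
    if d: "d \<in> D" and f: "linear_form scale f" for d f
  proof
    note intros = ad_intros form_comp[OF f]
    have "tw d (\<lambda>a b. scale (f a) b) = sR (\<lambda>r t. ad r (sw d (\<lambda>a b. scale (f (a * antipode t)) b)))"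
      unfolding tw_sw
      by (subst tsum_swap) (simp add: intros lin_tsumD[where f = "ad g" for g]
          lin_scaleD[where f = "ad g" for g])
    also have "\<dots> \<in> D"
      by (intro tsum_in_subspace D coideal d intros)
    finally show "tw d (\<lambda>a b. scale (f a) b) \<in> D" .
    have "tw d (\<lambda>a b. scale (f b) a) = sR (\<lambda>r t. sw d (\<lambda>a b. scale (f (r * a)) (ad t b)))"
      by (rule tw_braided) (intro intros)
    also have "\<dots> = sR (\<lambda>r t. ad t (sw d (\<lambda>a b. scale (f (r * a)) b)))"
      by (simp add: intros lin_tsumD[where f = "ad g" for g] lin_scaleD[where f = "ad g" for g])
    also have "\<dots> \<in> D"
      by (intro tsum_in_subspace D coideal d intros)
    finally show "tw d (\<lambda>a b. scale (f b) a) \<in> D" .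
  qed
  then show "adjoint_stable_subcoalgebra scale comult antipode R D"
    using D in_tensor_self_iff[OF fd, of D]
    by (auto simp: adjoint_stable_subcoalgebra_def subcoalgebra_def)
qed

end

context hopf_algebra_with_integrals
begin

lemma cointegral_absorb:
  assumes F: "lin F"
  shows "sw z (\<lambda>c d. scale (\<mu> c) (F d)) = scale (\<mu> z) (F 1)"
  using lin_tsumD[OF F, of "comult z" "\<lambda>c d. scale (\<mu> c) d"]
  by (simp add: cointegral_first lin_scaleD[OF F])

text \<open>
  Maschke's theorem for Yetter-Drinfeld modules, for submodules of H. A linear projection \<pi> onto D is
  averaged twice:
    p(v) = \<Lambda>1 \<cdot> \<pi>(S(\<Lambda>2) \<cdot> v) is H-linear, and
    P(v) = \<mu>(S(v1) p(v2)1) p(v2)2 is moreover colinear.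
  That the second average preserves H-linearity is the twisted trace property of \<mu>. Both averages fix D
  pointwise, since the integrals are normalized, so the kernel of P is a complement.
\<close>

theorem yetter_drinfeld_complement:
  assumes D: "yetter_drinfeld_submodule scale scale ad comult D"
  obtains D' where "yetter_drinfeld_submodule scale scale ad comult D'" "complementary D D'"
proof -
  have sD: "subspace D" and adD: "\<And>h d. d \<in> D \<Longrightarrow> ad h d \<in> D"
    and coideal: "\<And>f d. d \<in> D \<Longrightarrow> linear_form scale f \<Longrightarrow> sw d (\<lambda>a b. scale (f a) b) \<in> D"
    using D by (auto simp: yetter_drinfeld_submodule_iff[OF finite_dim])
  interpret pair: vector_space_pair scale scale ..
  obtain \<pi> where \<pi>: "lin \<pi>" "\<And>x. \<pi> x \<in> D" "\<And>x. x \<in> D \<Longrightarrow> \<pi> x = x"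
    using pair.linear_exists_left_inverse_on[OF lin_id sD] by auto
  have lin_\<pi>: "lin f \<Longrightarrow> lin (\<lambda>x. \<pi> (f x))" for f by (rule lin_comp[OF \<pi>(1)])
  define p where "p v = sw \<Lambda> (\<lambda>x y. ad x (\<pi> (ad (antipode y) v)))" for v
  have lin_p: "lin f \<Longrightarrow> lin (\<lambda>x. p (f x))" for f
    unfolding p_def by (intro int_intros lin_\<pi>)
  have p_D: "p v \<in> D" for v
    unfolding p_def by (intro tsum_in_subspace sD adD \<pi>)
  have p_id: "p d = d" if d: "d \<in> D" for d
  proof -
    have "p d = sw \<Lambda> (\<lambda>x y. ad (x * antipode y) d)"
      by (simp add: p_def \<pi>(3) adD d ad_mult)
    also have "\<dots> = scale (counit \<Lambda>) (ad 1 d)"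
      by (rule sw_antipode_right) (intro int_intros)
    finally show ?thesis by (simp add: counit_integral ad_one)
  qed
  have p_ad: "ad h (p v) = p (ad h v)" for h v
  proof -
    have "ad h (p v) = sw \<Lambda> (\<lambda>x y. ad (h * x) (\<pi> (ad (antipode y) v)))"
      unfolding p_def by (simp add: int_intros lin_tsumD[where f = "ad h"] ad_mult)
    also have "\<dots> = sw \<Lambda> (\<lambda>x y. ad x (\<pi> (ad (antipode y * h) v)))"
      by (rule integral_casimir) (intro int_intros lin_\<pi>)
    finally show ?thesis by (simp add: p_def ad_mult)
  qed
  define G where "G c w = sw w (\<lambda>x y. scale (\<mu> (antipode c * x)) y)" for c w
  define P where "P v = sw v (\<lambda>a w. G a (p w))" for v
  have lin_G1: "lin f \<Longrightarrow> lin (\<lambda>x. G (f x) w)" for f w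
    unfolding G_def by (intro int_intros)
  have lin_G2: "lin f \<Longrightarrow> lin (\<lambda>x. G c (f x))" for f c
    unfolding G_def by (intro int_intros)
  note intros = int_intros lin_\<pi> lin_p lin_G1 lin_G2
  have lin_P: "lin f \<Longrightarrow> lin (\<lambda>x. P (f x))" for f
    unfolding P_def by (intro intros)
  have P_D: "P v \<in> D" for v
    unfolding P_def G_def by (intro tsum_in_subspace sD coideal p_D intros)
  have P_id: "P d = d" if d: "d \<in> D" for d
  proof -
    obtain s where s: "set s \<subseteq> UNIV \<times> D" "tensor_eq scale scale (comult d) s"
      using D d by (auto simp: yetter_drinfeld_submodule_def in_tensor_def)
    \<comment> \<open>The second legs of the coproduct of d can be taken in D, where p is the identity.\<close>
    have "P d = tsum s (\<lambda>a w. G a (p w))"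
      unfolding P_def by (rule tsum_eq_bilin[OF s(2)]) (intro intros)
    also have "\<dots> = tsum s G"
      using s(1) p_id by (intro tsum_cong) auto
    also have "\<dots> = sw d G"
      by (rule tsum_eq_bilin[OF s(2), symmetric]) (intro intros)
    also have "\<dots> = sw d (\<lambda>k y. sw k (\<lambda>a x. scale (\<mu> (antipode a * x)) y))"
      unfolding G_def by (rule sw_coassoc[symmetric]; intro intros)
    also have "\<dots> = sw d (\<lambda>k y. scale (counit k) (scale (\<mu> 1) y))"
      using sw_antipode_left[where f = "\<lambda>z. scale (\<mu> z) y" for y] by (simp add: intros)
    also have "\<dots> = d"
      by (subst sw_counit_left) (auto intro: intros simp: cointegral_one)
    finally show ?thesis .
  qed
  have P_ad: "P (ad h v) = ad h (P v)" for h v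
  proof -
    let ?T = "\<lambda>g1 c g2 g3 h3. sw v (\<lambda>a w. sw (p w) (\<lambda>x y.
      scale (\<mu> (antipode a * (antipode g1 * c) * (x * (antipode g3 * h3)))) (ad g2 y)))"
    \<comment> \<open>With legs h1, (g1, g2, g3), h3 of h, the factor S(h1) cancels g1 and S(g3) cancels h3.\<close>
    have "P (ad h v) = sw h (\<lambda>k h3. sw k (\<lambda>h1 h2. sw v (\<lambda>a w. G (h1 * a * antipode h3) (p (ad h2 w)))))"
      unfolding P_def by (rule comult_ad) (intro intros)
    also have "\<dots> = sw h (\<lambda>k h3. sw k (\<lambda>h1 h2. sw v (\<lambda>a w. sw h2 (\<lambda>m g3. sw m (\<lambda>g1 g2. sw (p w) (\<lambda>x y.
      scale (\<mu> (antipode (antipode h3) * (antipode a * antipode h1 * (g1 * x * antipode g3)))) (ad g2 y)))))))"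
      unfolding G_def p_ad[symmetric]
      by (subst comult_ad; (intro intros | simp add: antipode_mult mult.assoc))
    also have "\<dots> = sw h (\<lambda>k h3. sw k (\<lambda>h1 h2. sw h2 (\<lambda>m g3. sw m (\<lambda>g1 g2. ?T h1 g1 g2 g3 h3))))"
      \<comment> \<open>The factor S(S(h3)) moves to the right end, next to S(g3), where it becomes h3.\<close>
      unfolding cointegral_trace[symmetric]
      by (subst (3) tsum_swap, subst (4) tsum_swap) (simp add: mult.assoc)
    also have "\<dots> = sw h (\<lambda>k h3. sw k (\<lambda>h1 h2. sw h2 (\<lambda>g1 m. sw m (\<lambda>g2 g3. ?T h1 g1 g2 g3 h3))))"
    proof -
      have "sw h2 (\<lambda>m g3. sw m (\<lambda>g1 g2. ?T h1 g1 g2 g3 h3)) = sw h2 (\<lambda>g1 m. sw m (\<lambda>g2 g3. ?T h1 g1 g2 g3 h3))"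
        for h1 h2 h3
        by (rule sw_coassoc; intro intros)
      then show ?thesis by simp
    qed
    also have "\<dots> = sw h (\<lambda>k h3. sw k (\<lambda>l m. sw l (\<lambda>h1 g1. sw m (\<lambda>g2 g3. ?T h1 g1 g2 g3 h3))))"
    proof -
      have "sw k (\<lambda>h1 h2. sw h2 (\<lambda>g1 m. sw m (\<lambda>g2 g3. ?T h1 g1 g2 g3 h3)))
        = sw k (\<lambda>l m. sw l (\<lambda>h1 g1. sw m (\<lambda>g2 g3. ?T h1 g1 g2 g3 h3)))" for k h3
        by (rule sw_coassoc[symmetric]; intro intros)
      then show ?thesis by simp
    qed
    also have "\<dots> = sw h (\<lambda>k h3. sw k (\<lambda>l m. scale (counit l) (sw m (\<lambda>g2 g3. ?T 1 1 g2 g3 h3))))"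
    proof -
      have "sw l (\<lambda>h1 g1. sw m (\<lambda>g2 g3. ?T h1 g1 g2 g3 h3))
        = scale (counit l) (sw m (\<lambda>g2 g3. ?T 1 1 g2 g3 h3))" for l m h3
        using sw_antipode_left[where f = "\<lambda>z. sw m (\<lambda>g2 g3. sw v (\<lambda>a w. sw (p w) (\<lambda>x y.
          scale (\<mu> (antipode a * z * (x * (antipode g3 * h3)))) (ad g2 y))))"]
        by (simp add: intros antipode_one)
      then show ?thesis by simp
    qed
    also have "\<dots> = sw h (\<lambda>k h3. sw k (\<lambda>g2 g3. ?T 1 1 g2 g3 h3))"
      by (subst sw_counit_left; (intro intros | simp))
    also have "\<dots> = sw h (\<lambda>g2 n. sw n (\<lambda>g3 h3. ?T 1 1 g2 g3 h3))"
      by (rule sw_coassoc; intro intros)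
    also have "\<dots> = sw h (\<lambda>g2 n. scale (counit n) (?T 1 1 g2 1 1))"
    proof -
      have "sw n (\<lambda>g3 h3. ?T 1 1 g2 g3 h3) = scale (counit n) (?T 1 1 g2 1 1)" for n g2
        using sw_antipode_left[where f = "\<lambda>z. sw v (\<lambda>a w. sw (p w) (\<lambda>x y.
          scale (\<mu> (antipode a * (x * z))) (ad g2 y)))"]
        by (simp add: intros antipode_one)
      then show ?thesis by simp
    qed
    also have "\<dots> = ?T 1 1 h 1 1"
      by (rule sw_counit_right) (intro intros)
    also have "\<dots> = ad h (P v)"
      unfolding P_def G_def
      by (simp add: antipode_one intros lin_tsumD[where f = "ad h"] lin_scaleD[where f = "ad h"])
    finally show ?thesis .
  qed
  have P_coideal: "sw (P v) (\<lambda>x y. scale (f x) y) = sw v (\<lambda>a b. scale (f a) (P b))"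
    if f: "linear_form scale f" for f v
  proof -
    note intros = intros form_comp[OF f]
    let ?Y = "\<lambda>a b s w. sw (p w) (\<lambda>x y. sw x (\<lambda>x1 x2.
      scale (\<mu> (antipode s * x1)) (scale (f (a * antipode b * x2)) y)))"
    have "sw v (\<lambda>a b. scale (f a) (P b))
      = sw v (\<lambda>a b. sw b (\<lambda>c w. sw c (\<lambda>s1 s2. ?Y a s1 s2 w)))"
    proof -
      have "scale (f a) (G c w) = sw c (\<lambda>s1 s2. sw w (\<lambda>x y. sw x (\<lambda>x1 x2.
          scale (\<mu> (antipode s2 * x1)) (scale (f (a * antipode s1 * x2)) y))))" for a c w
      proof -
        have "scale (f a) (G c w) = sw w (\<lambda>x y. scale (\<mu> (antipode c * x)) (scale (f (a * 1)) y))"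
          unfolding G_def by (simp add: scale_tsum mult.commute)
        \<comment> \<open>The cointegral absorbs a coproduct of S(c) x, which brings S(c) next to a.\<close>
        also have "\<dots> = sw w (\<lambda>x y. sw (antipode c * x) (\<lambda>z u. scale (\<mu> z) (scale (f (a * u)) y)))"
          by (subst cointegral_absorb; (intro intros | simp))
        also have "\<dots> = sw w (\<lambda>x y. sw c (\<lambda>s1 s2. sw x (\<lambda>x1 x2.
            scale (\<mu> (antipode s2 * x1)) (scale (f (a * (antipode s1 * x2))) y))))"
          by (simp add: sw_mult comult_antipode intros)
        finally show ?thesis by (subst tsum_swap) (simp add: mult.assoc)
      qed
      then show ?thesis unfolding P_def by (simp add: scale_tsum)
    qed
    also have "\<dots> = sw v (\<lambda>a b. sw b (\<lambda>s1 m. sw m (\<lambda>s2 w. ?Y a s1 s2 w)))"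
    proof -
      have "sw b (\<lambda>c w. sw c (\<lambda>s1 s2. ?Y a s1 s2 w)) = sw b (\<lambda>s1 m. sw m (\<lambda>s2 w. ?Y a s1 s2 w))" for a b
        by (rule sw_coassoc; intro intros)
      then show ?thesis by (simp only:)
    qed
    also have "\<dots> = sw v (\<lambda>k m. sw k (\<lambda>a s1. sw m (\<lambda>s2 w. ?Y a s1 s2 w)))"
      by (rule sw_coassoc[symmetric]; intro intros)
    also have "\<dots> = sw v (\<lambda>k m. scale (counit k) (sw m (\<lambda>s2 w. ?Y 1 1 s2 w)))"
    proof -
      have "sw k (\<lambda>a s1. sw m (\<lambda>s2 w. ?Y a s1 s2 w)) = scale (counit k) (sw m (\<lambda>s2 w. ?Y 1 1 s2 w))" for k m
        using sw_antipode_right[where f = "\<lambda>z. sw m (\<lambda>s w. sw (p w) (\<lambda>x y. sw x (\<lambda>x1 x2.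
          scale (\<mu> (antipode s * x1)) (scale (f (z * x2)) y))))"]
        by (simp add: intros antipode_one)
      then show ?thesis by simp
    qed
    also have "\<dots> = sw v (\<lambda>s2 w. ?Y 1 1 s2 w)"
      by (rule sw_counit_left) (intro intros)
    also have "\<dots> = sw v (\<lambda>s2 w. sw (p w) (\<lambda>x m. sw m (\<lambda>x2 y.
      scale (\<mu> (antipode s2 * x)) (scale (f x2) y))))"
    proof -
      have "sw u (\<lambda>x y. sw x (\<lambda>x1 x2. scale (\<mu> (antipode s * x1)) (scale (f (1 * antipode 1 * x2)) y)))
        = sw u (\<lambda>x m. sw m (\<lambda>x2 y. scale (\<mu> (antipode s * x)) (scale (f x2) y)))" for u s
        unfolding antipode_one mult_1_left by (rule sw_coassoc; intro intros)
      then show ?thesis by (simp only:)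
    qed
    also have "\<dots> = sw (P v) (\<lambda>x y. scale (f x) y)"
      unfolding P_def G_def
      by (simp add: scale_tsum lin_tsumD[where f = "\<lambda>z. sw z (\<lambda>x y. scale (f x) y)"]
          lin_scaleD[where f = "\<lambda>z. sw z (\<lambda>x y. scale (f x) y)"] intros)
    finally show ?thesis by simp
  qed
  let ?K = "{v. P v = 0}"
  have lin: "lin P" by (rule lin_P[OF lin_id])
  have sK: "subspace ?K"
    by (auto simp: subspace_def lin_addD[OF lin] lin_scaleD[OF lin] lin_zeroD[OF lin])
  have "yetter_drinfeld_submodule scale scale ad comult ?K"
    unfolding yetter_drinfeld_submodule_iff[OF finite_dim]
  proof (intro conjI allI ballI impI sK)
    fix h d assume d: "d \<in> ?K"
    show "ad h d \<in> ?K" using d by (simp add: P_ad lin_zeroD[OF lin_ad_second[OF lin_id]])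
  next
    fix f d assume d: "d \<in> ?K" and f: "linear_form scale f"
    have "P (sw d (\<lambda>a b. scale (f a) b)) = sw (P d) (\<lambda>x y. scale (f x) y)"
      by (simp add: P_coideal[OF f] lin_tsumD[OF lin] lin_scaleD[OF lin])
    also have "\<dots> = 0"
      using d f lin_zeroD[OF lin_sw[OF lin_id], of "\<lambda>x y. scale (f x) y"] by (simp add: hopf_intros)
    finally show "sw d (\<lambda>a b. scale (f a) b) \<in> ?K" by simp
  qed
  moreover have "complementary D ?K"
    unfolding complementary_def
  proof (intro conjI allI sD sK)
    show "D \<inter> ?K = {0}"
      using P_id subspace_0[OF sD] by (auto simp: lin_zeroD[OF lin])
    have "P (x - P x) = 0" for x
      using lin_addD[OF lin, of "x - P x" "P x"] by (simp add: P_id P_D)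
    then show "\<exists>u\<in>D. x - u \<in> ?K" for x
      using P_D by (intro bexI[of _ "P x"]) simp_all
  qed
  ultimately show thesis using that by blast
qed

end


section \<open>Decomposition into minimal subcoalgebras\<close>

context scalar_space
begin

text \<open>
  The summands that meet a basis chosen inside the union of all summands already generate the whole
  space, and no other nonzero summand can be independent of them.
\<close>

lemma finite_direct_sum_decomposition:
  assumes fd: "finite_dimensional scale" and dec: "direct_sum_decomposition scale \<D>"
    and nz: "\<And>D. D \<in> \<D> \<Longrightarrow> D \<noteq> {0}"
  shows "finite \<D>"
proof -
  obtain S where S: "finite S" "span S = UNIV"
    using fd by (auto simp: finite_dimensional_def)
  obtain B where B: "B \<subseteq> \<Union>\<D>" "independent B" "\<Union>\<D> \<subseteq> span B"
    by (rule maximal_independent_subset[of "\<Union>\<D>"])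
  have "finite B" using independent_span_bound[of S B] S B(2) by simp
  have "\<forall>b\<in>B. \<exists>D. D \<in> \<D> \<and> b \<in> D" using B(1) by blast
  then obtain d where d: "\<And>b. b \<in> B \<Longrightarrow> d b \<in> \<D> \<and> b \<in> d b" by metis
  have "\<D> \<subseteq> d ` B"
  proof
    fix D assume D: "D \<in> \<D>"
    show "D \<in> d ` B"
    proof (rule ccontr)
      assume "D \<notin> d ` B"
      then have "B \<subseteq> span (\<Union>(\<D> - {D}))"
        using d by (auto intro!: span_base)
      then have "span (\<Union>\<D>) \<subseteq> span (\<Union>(\<D> - {D}))"
        using B(3) by (intro span_minimal subspace_span) (meson span_minimal subset_trans subspace_span)
      moreover have "span (\<Union>\<D>) = UNIV" "D \<inter> span (\<Union>(\<D> - {D})) = {0}"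
        using dec D by (auto simp: direct_sum_decomposition_def)
      ultimately have "D = {0}" by blast
      then show False using nz[OF D] by simp
    qed
  qed
  then show ?thesis using \<open>finite B\<close> finite_surj by blast
qed

lemma minimal_nonzero_exists:
  assumes fd: "finite_dimensional scale" and subspace: "\<And>D. P D \<Longrightarrow> subspace D"
    and W: "P W" "W \<noteq> {0}"
  obtains D where "minimal_nonzero P D" "D \<subseteq> W"
proof -
  obtain B where B: "finite B" "independent B" "span B = UNIV"
    by (rule finite_dimensional_basis[OF fd])
  interpret fd: finite_dimensional_vector_space scale B
    by unfold_locales (use B in auto)
  let ?Q = "\<lambda>D. P D \<and> D \<noteq> {0} \<and> D \<subseteq> W"
  obtain D where D: "?Q D" and least: "\<And>E. ?Q E \<Longrightarrow> dim D \<le> dim E"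
    using ex_has_least_nat[of ?Q W dim] W by auto
  have "E = D" if "P E" "E \<noteq> {0}" "E \<subseteq> D" for E
    using least[of E] that D by (intro fd.subspace_dim_equal subspace) auto
  then have "minimal_nonzero P D" using D by (auto simp: minimal_nonzero_def)
  with D that show thesis by blast
qed

text \<open>
  If each subspace with property P has a complement with property P, and such a complement of a minimal E
  contains all the other minimal subspaces, then the set of all minimal subspaces is independent: a
  minimal D meets the sum of the others, which lies in a complement of D, trivially. For the same reason
  no minimal subspace can be missing from a decomposition.
\<close>

lemma unique_decomposition_into_minimals:
  assumes fd: "finite_dimensional scale"
    and subspace: "\<And>D. P D \<Longrightarrow> subspace D"
    and sum: "\<And>\<D>. (\<And>D. D \<in> \<D> \<Longrightarrow> P D) \<Longrightarrow> P (span (\<Union>\<D>))"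
    and complement: "\<And>D. P D \<Longrightarrow> \<exists>D'. P D' \<and> complementary D D'"
    and separation: "\<And>D E E'. minimal_nonzero P D \<Longrightarrow> minimal_nonzero P E \<Longrightarrow> D \<noteq> E \<Longrightarrow>
      P E' \<Longrightarrow> complementary E E' \<Longrightarrow> D \<subseteq> E'"
  shows "finite \<D> \<and> direct_sum_decomposition scale \<D> \<and> (\<forall>D\<in>\<D>. minimal_nonzero P D)
    \<longleftrightarrow> \<D> = {D. minimal_nonzero P D}" (is "?dec \<D> \<longleftrightarrow> \<D> = ?M")
proof
  have others: "D \<inter> span (\<Union>\<E>) = {0}"
    if D: "minimal_nonzero P D" and \<E>: "\<E> \<subseteq> ?M - {D}" for D \<E>
  proof -
    have PD: "P D" using D by (simp add: minimal_nonzero_def)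
    obtain D' where D': "P D'" "complementary D D'" using complement[OF PD] by blast
    have "\<Union>\<E> \<subseteq> D'" using separation[OF _ D _ D'] \<E> by blast
    then have "span (\<Union>\<E>) \<subseteq> D'" using subspace[OF D'(1)] by (rule span_minimal)
    then show ?thesis
      using D'(2) subspace_0[OF subspace[OF PD]] span_zero unfolding complementary_def by blast
  qed
  {
    assume \<D>: "?dec \<D>"
    have "D \<in> \<D>" if D: "minimal_nonzero P D" for D
    proof (rule ccontr)
      assume "D \<notin> \<D>"
      then have "D \<inter> span (\<Union>\<D>) = {0}" using \<D> by (intro others[OF D]) auto
      then show False
        using \<D> D by (simp add: direct_sum_decomposition_def minimal_nonzero_def)
    qed
    then show "\<D> = ?M" using \<D> by blast
  }
  assume \<D>: "\<D> = ?M"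
  have PM: "P D" if "D \<in> ?M" for D using that by (simp add: minimal_nonzero_def)
  have "span (\<Union>?M) = UNIV"
  proof -
    obtain W where W: "P W" "complementary (span (\<Union>?M)) W"
      using complement[OF sum[of ?M]] PM by blast
    have "W = {0}"
    proof (rule ccontr)
      assume "W \<noteq> {0}"
      obtain D where D: "minimal_nonzero P D" "D \<subseteq> W"
        by (rule minimal_nonzero_exists[where P = P, OF fd subspace W(1) \<open>W \<noteq> {0}\<close>]) simp_all
      then have "D \<subseteq> span (\<Union>?M)" by (auto intro: span_base)
      then have "D \<subseteq> {0}" using D(2) W(2) unfolding complementary_def by blast
      moreover have "0 \<in> D" using D(1) subspace_0 subspace by (auto simp: minimal_nonzero_def)
      ultimately have "D = {0}" by blast
      then show False using D(1) by (simp add: minimal_nonzero_def)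
    qed
    then show ?thesis using W(2) by (auto simp: complementary_def)
  qed
  then have dec: "direct_sum_decomposition scale ?M"
    unfolding direct_sum_decomposition_def using others subspace PM by auto
  have "finite ?M"
    by (rule finite_direct_sum_decomposition[OF fd dec]) (simp add: minimal_nonzero_def)
  with dec show "?dec \<D>" unfolding \<D> by simp
qed

end

context quasitriangular_hopf_algebra
begin

lemma lin_tw:
  assumes \<beta>: "bilin \<beta>"
  shows "lin (\<lambda>h. tw h \<beta>)"
  unfolding tw_sw by (intro ad_intros bilin_first[OF \<beta>] bilin_second[OF \<beta>] lin_tsum)

text \<open>
  For a decomposition of H_R into subcoalgebras E and E', the projection \<pi> onto E is the map
  h \<mapsto> \<epsilon>(\<pi>(h'')) h' in terms of \<Delta>_R(h) = h' \<otimes> h''. Hence \<pi> preserves every subcoalgebra D, and \<pi>(D) is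
  contained in D \<inter> E, which is zero for distinct minimal D and E.
\<close>

lemma adjoint_stable_subcoalgebra_separation:
  fixes P
  defines "P \<equiv> adjoint_stable_subcoalgebra scale comult antipode R"
  assumes fd: "finite_dimensional scale"
    and D: "minimal_nonzero P D" and E: "minimal_nonzero P E" and "D \<noteq> E"
    and E': "P E'" "complementary E E'"
  shows "D \<subseteq> E'"
proof -
  have PD: "P D" and PE: "P E" using D E by (auto simp: minimal_nonzero_def)
  obtain \<pi> where \<pi>: "lin \<pi>" "\<And>x. \<pi> x \<in> E" "\<And>x. x - \<pi> x \<in> E'"
    "\<And>x. x \<in> E \<Longrightarrow> \<pi> x = x" "\<And>x. x \<in> E' \<Longrightarrow> \<pi> x = 0"
    by (rule complementary_projection[OF E'(2)]) blast
  let ?\<beta> = "\<lambda>a b. scale (counit (\<pi> b)) a"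
  have \<pi>_lin: "lin f \<Longrightarrow> lin (\<lambda>x. \<pi> (f x))" for f by (rule lin_comp[OF \<pi>(1)])
  have \<beta>: "bilin ?\<beta>" by (intro ad_intros \<pi>_lin)
  have local: "tw x ?\<beta> = tw x \<gamma>"
    if W: "P W" "x \<in> W" and \<gamma>: "bilin \<gamma>" "\<And>a b. b \<in> W \<Longrightarrow> ?\<beta> a b = \<gamma> a b" for W x \<gamma>
  proof -
    obtain s where s: "set s \<subseteq> W \<times> W" "tensor_eq scale scale (transmuted_comult comult antipode R x) s"
      using W by (auto simp: P_def adjoint_stable_subcoalgebra_def subcoalgebra_def in_tensor_def)
    have "tsum s ?\<beta> = tsum s \<gamma>"
      using s(1) \<gamma>(2) by (intro tsum_cong) blast
    then show ?thesis
      using tsum_eq_bilin[OF s(2) \<beta>] tsum_eq_bilin[OF s(2) \<gamma>(1)] by simp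
  qed
  have proj: "tw x ?\<beta> = \<pi> x" for x
  proof -
    have "tw x ?\<beta> = tw (\<pi> x) ?\<beta> + tw (x - \<pi> x) ?\<beta>"
      using lin_addD[OF lin_tw[OF \<beta>], of "\<pi> x" "x - \<pi> x"] by simp
    also have "tw (\<pi> x) ?\<beta> = tw (\<pi> x) (\<lambda>a b. scale (counit b) a)"
    proof (rule local[OF PE \<pi>(2)])
      show "bilin (\<lambda>a b. scale (counit b) a)" by (intro ad_intros)
    qed (simp add: \<pi>(4))
    also have "\<dots> = \<pi> x" by (rule tw_counit_right)
    also have "tw (x - \<pi> x) ?\<beta> = tw (x - \<pi> x) (\<lambda>a b. 0)"
    proof (rule local[OF E'(1) \<pi>(3)])
      have "lin (\<lambda>x. 0)" by (rule linI) auto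
      then show "bilin (\<lambda>a b. 0)" by (intro bilinI)
    qed (simp add: \<pi>(5) form_zeroD[OF counit_linear])
    finally show ?thesis by simp
  qed
  have "\<pi> x \<in> D" if x: "x \<in> D" for x
  proof -
    have "in_tensor scale scale D D (transmuted_comult comult antipode R x)" "subspace D"
      using PD x by (auto simp: P_def adjoint_stable_subcoalgebra_def subcoalgebra_def)
    moreover have "linear_form scale (\<lambda>x. counit (\<pi> x))" by (intro ad_intros \<pi>_lin)
    ultimately have "tw x ?\<beta> \<in> D" using in_tensor_self_iff[OF fd] by blast
    then show ?thesis by (simp add: proj)
  qed
  moreover have "P (D \<inter> E)"
    using PD PE unfolding P_def adjoint_stable_subcoalgebra_iff_yetter_drinfeld_submodule[OF fd]
      yetter_drinfeld_submodule_iff[OF fd] by (auto intro: subspace_inter)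
  then have "D \<inter> E = {0}"
    using D E \<open>D \<noteq> E\<close> unfolding minimal_nonzero_def by blast
  ultimately have "\<pi> x = 0" if "x \<in> D" for x
    using \<pi>(2) that by blast
  then show "D \<subseteq> E'" using \<pi>(3) by (metis diff_zero subsetI)
qed

lemma yetter_drinfeld_submodule_span_Union:
  assumes fd: "finite_dimensional scale"
    and YD: "\<And>D. D \<in> \<D> \<Longrightarrow> yetter_drinfeld_submodule scale scale ad comult D"
  shows "yetter_drinfeld_submodule scale scale ad comult (span (\<Union>\<D>))"
proof -
  let ?F = "range ad \<union> {\<lambda>h. sw h (\<lambda>a b. scale (f a) b) | f. linear_form scale f}"
  have iff: "yetter_drinfeld_submodule scale scale ad comult D \<longleftrightarrow> invariant_subspace ?F D" for D
    unfolding yetter_drinfeld_submodule_iff[OF fd] invariant_subspace_def by auto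
  have "lin T" if "T \<in> ?F" for T
    using that by (auto intro!: ad_intros)
  with YD show ?thesis
    unfolding iff by (intro invariant_subspace_span_Union)
qed

end

theorem proposition3p5:
  fixes scale :: "'k::field \<Rightarrow> 'h::ring_1 \<Rightarrow> 'h"
    and comult :: "'h \<Rightarrow> ('h \<times> 'h) list"
    and counit :: "'h \<Rightarrow> 'k"
    and antipode :: "'h \<Rightarrow> 'h"
    and R :: "('h \<times> 'h) list"
  assumes "quasitriangular_hopf_algebra scale comult counit antipode R"
    and "finite_dimensional scale"
    and "semisimple_algebra scale"
    and "cosemisimple_coalgebra scale comult"
  shows "(\<exists>!\<D>. minimal_subcoalgebra_decomposition scale comult antipode R \<D>) \<and>
    yetter_drinfeld_module scale comult counit antipode scale
      (adjoint_action comult antipode) comult \<and>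
    (\<forall>\<D>. minimal_subcoalgebra_decomposition scale comult antipode R \<D> \<longrightarrow>
      (\<forall>\<E>. irreducible_yetter_drinfeld_decomposition scale comult antipode \<E> \<longleftrightarrow> \<E> = \<D>))"
proof -
  interpret quasitriangular_hopf_algebra scale comult counit antipode R by fact
  note fd = assms(2)
  obtain \<Lambda> where \<Lambda>: "counit \<Lambda> = 1" "\<And>h. h * \<Lambda> = scale (counit h) \<Lambda>" "\<And>h. \<Lambda> * h = scale (counit h) \<Lambda>"
    by (rule normalized_integral[OF fd assms(3)]) blast
  obtain \<mu> where \<mu>: "linear_form scale \<mu>" "\<mu> 1 = 1"
    "\<And>h. sw h (\<lambda>a b. scale (\<mu> a) b) = scale (\<mu> h) 1"
    "\<And>h. sw h (\<lambda>a b. scale (\<mu> b) a) = scale (\<mu> h) 1"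
    by (rule normalized_cointegral[OF fd assms(4) counit_one sw_one], assumption, rule that)
  interpret hopf_algebra_with_integrals scale comult counit antipode \<Lambda> \<mu>
    by (intro hopf_algebra_with_integrals.intro hopf_algebra_with_integrals_axioms.intro
        hopf_algebra_axioms fd \<Lambda> \<mu>)
  let ?P = "yetter_drinfeld_submodule scale scale ad comult"
  have eq: "adjoint_stable_subcoalgebra scale comult antipode R = ?P"
    using adjoint_stable_subcoalgebra_iff_yetter_drinfeld_submodule[OF fd] by (intro ext)
  have "finite \<D> \<and> direct_sum_decomposition scale \<D> \<and> (\<forall>D\<in>\<D>. minimal_nonzero ?P D)
    \<longleftrightarrow> \<D> = {D. minimal_nonzero ?P D}" for \<D>
  proof (rule unique_decomposition_into_minimals[OF fd])
    show "subspace D" if "?P D" for D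
      using that by (simp add: yetter_drinfeld_submodule_def)
    show "?P (span (\<Union>\<D>))" if "\<And>D. D \<in> \<D> \<Longrightarrow> ?P D" for \<D>
      using that by (rule yetter_drinfeld_submodule_span_Union[OF fd])
    show "\<exists>D'. ?P D' \<and> complementary D D'" if "?P D" for D
      using yetter_drinfeld_complement[OF that] by blast
    show "D \<subseteq> E'" if "minimal_nonzero ?P D" "minimal_nonzero ?P E" "D \<noteq> E" "?P E'" "complementary E E'"
      for D E E'
      using adjoint_stable_subcoalgebra_separation[OF fd] that unfolding eq .
  qed
  then show ?thesis
    using yetter_drinfeld_module_adjoint[OF fd]
    unfolding minimal_subcoalgebra_decomposition_def irreducible_yetter_drinfeld_decomposition_def eq
    by simp
qed

end
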